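(* Let $n \geq 1$, let $S$ be a semifield and let $T\colon M_n(S) \to M_n(S)$ be a bijective linear map. Then the following are equivalent: (i) $T$ preserves $\mathcal{J}$; (ii) $T$ preserves $\leq_{\mathcal{J}}$; (iii) $T$ preserves $\mathcal{H}$; (iv) $T$ preserves $\leq_{\mathcal{H}}$; (v) there exist $P, Q \in GL_n(S)$ such that either $T(A) = PAQ$ for all $A \in M_n(S)$ or $T(A) = PA^TQ$ for all $A \in M_n(S)$.
   Context: A semifield is a set $S$ with two associative commutative binary operations $+$ and $\times$ such that $\times$ distributes over $+$, there is an element $0$ which is an identity for $+$ and a zero element for $\times$, and $S \setminus \{0\}$ is a group under $\times$ with identity denoted $1$ (so every field is a semifield; additive inverses need not exist). $M_n(S)$ is the set of $n \times n$ matrices over $S$, viewed both as an $S$-module (entrywise addition and scaling) and as a monoid under matrix multiplication; $GL_n(S)$ is the group of multiplicatively invertible elements of $M_n(S)$; $A^T$ is the transpose of $A$. A map $T$ on $M_n(S)$ is linear if $T(A+B)=T(A)+T(B)$ and $T(sA)=sT(A)$ for all $A,B \in M_n(S)$, $s \in S$. Green's relations on $M_n(S)$: $A \leq_{\mathcal{L}} B$ if $A = XB$ for some $X \in M_n(S)$; $A \leq_{\mathcal{R}} B$ if $A = BX$ for some $X \in M_n(S)$; $A \leq_{\mathcal{H}} B$ if $A \leq_{\mathcal{L}} B$ and $A \leq_{\mathcal{R}} B$; $A\,\mathcal{H}\,B$ if $A \leq_{\mathcal{H}} B$ and $B \leq_{\mathcal{H}} A$; $A \leq_{\mathcal{J}}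 B$ if $A = XBY$ for some $X, Y \in M_n(S)$; $A\,\mathcal{J}\,B$ if $A \leq_{\mathcal{J}} B$ and $B \leq_{\mathcal{J}} A$. A map $T$ preserves a binary relation $\equiv$ on $M_n(S)$ if $A \equiv B$ implies $T(A) \equiv T(B)$ for all $A,B \in M_n(S)$. *)

theory Defs
  imports "HOL-Analysis.Analysis"
begin

text \<open>
  The nonzero elements form a group under multiplication. In particular \<open>0 \<noteq> 1\<close>, which is
  inherited from \<open>comm_semiring_1\<close>; closure of the nonzero elements under multiplication follows
  from the existence of inverses. Additive inverses are not required.
\<close>

class semifield = comm_semiring_1 +
  assumes nonzero_has_inverse: "a \<noteq> 0 \<Longrightarrow> \<exists>b. a * b = 1"

subclass (in field) semifield
proof
  fix a :: 'a
  assume "a \<noteq> 0"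
  then show "\<exists>b. a * b = 1"
    by (intro exI [of _ "inverse a"]) simp
qed

lemma (in semifield) semifield_mult_nonzero:
  assumes "a \<noteq> 0" and "b \<noteq> 0"
  shows "a * b \<noteq> 0"
proof
  assume ab: "a * b = 0"
  obtain a' where a': "a * a' = 1"
    using nonzero_has_inverse [OF assms(1)] by blast
  have "b = (a * a') * b"
    by (simp add: a')
  also have "\<dots> = (a * b) * a'"
    by (simp only: mult.assoc mult.commute [of a' b])
  also have "\<dots> = 0"
    by (simp add: ab)
  finally show False
    using assms(2) by simp
qed

definition mat_scale :: "'s::times \<Rightarrow> 's ^ 'n ^ 'm \<Rightarrow> 's ^ 'n ^ 'm"
  where "mat_scale s A = (\<chi> i j. s * A $ i $ j)"

text \<open>
  The library's linear maps presuppose additive inverses (\<open>Modules.module\<close> is over a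
  commutative ring acting on an abelian group), so linearity over a semifield is defined here.
\<close>

definition mat_linear :: "('s::semifield ^ 'n ^ 'n \<Rightarrow> 's ^ 'n ^ 'n) \<Rightarrow> bool"
  where "mat_linear T \<longleftrightarrow>
    (\<forall>A B. T (A + B) = T A + T B) \<and> (\<forall>s A. T (mat_scale s A) = mat_scale s (T A))"

definition leq_L :: "'s::semifield ^ 'n::finite ^ 'n \<Rightarrow> 's ^ 'n ^ 'n \<Rightarrow> bool"
  where "leq_L A B \<longleftrightarrow> (\<exists>X. A = X ** B)"

definition leq_R :: "'s::semifield ^ 'n::finite ^ 'n \<Rightarrow> 's ^ 'n ^ 'n \<Rightarrow> bool"
  where "leq_R A B \<longleftrightarrow> (\<exists>X. A = B ** X)"

definition leq_H :: "'s::semifield ^ 'n::finite ^ 'n \<Rightarrow> 's ^ 'n ^ 'n \<Rightarrow> bool"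
  where "leq_H A B \<longleftrightarrow> leq_L A B \<and> leq_R A B"

definition green_H :: "'s::semifield ^ 'n::finite ^ 'n \<Rightarrow> 's ^ 'n ^ 'n \<Rightarrow> bool"
  where "green_H A B \<longleftrightarrow> leq_H A B \<and> leq_H B A"

definition leq_J :: "'s::semifield ^ 'n::finite ^ 'n \<Rightarrow> 's ^ 'n ^ 'n \<Rightarrow> bool"
  where "leq_J A B \<longleftrightarrow> (\<exists>X Y. A = X ** B ** Y)"

definition green_J :: "'s::semifield ^ 'n::finite ^ 'n \<Rightarrow> 's ^ 'n ^ 'n \<Rightarrow> bool"
  where "green_J A B \<longleftrightarrow> leq_J A B \<and> leq_J B A"

definition preserves :: "('a \<Rightarrow> 'a) \<Rightarrow> ('a \<Rightarrow> 'a \<Rightarrow> bool) \<Rightarrow> bool"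
  where "preserves T R \<longleftrightarrow> (\<forall>A B. R A B \<longrightarrow> R (T A) (T B))"

end

theory Submission
  imports Defs
begin

text \<open>
  All four preservation properties are read off from nonzero outer products, that is, from nonzero
  matrices whose \<open>2 \<times> 2\<close> minors vanish. A semifield is either a field or zerosumfree, and in the
  latter case a bijective linear map permutes the matrix units up to scalars. If \<open>T\<close> preserves \<open>\<J>\<close>,
  it maps rank one to rank one: over a field, the alternative that no rank one matrix has an image
  of rank one is refuted by the minors along a pencil \<open>T (A (I + t E))\<close> with \<open>E\<close> nilpotent and \<open>T A\<close>
  of rank one, and by separate arguments over the two-element field. If \<open>T\<close> preserves \<open>\<H>\<close>, then the \<open>\<H>\<close>-class of any \<open>A\<close> for
  which \<open>T A\<close> has rank one consists of multiples of \<open>A\<close>, which over a field forces \<open>A\<close> to have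
  rank one; so here \<open>T\<^sup>-\<^sup>1\<close> is the map to look at.

  A map of this kind sends \<open>E\<^sub>i\<^sub>j\<close> to \<open>x\<^sub>i\<^sub>j y\<^sub>i\<^sub>j\<^sup>T\<close>, and for matrix units in a common row or column the
  left or the right factors are proportional. Each of the two proportionalities is an equivalence
  relation, which makes all rows of one type and all columns of the other. Up to transposition the
  map is then \<open>A \<mapsto> P (C \<circ> A) Q\<close> with an entrywise product, and it remains to see that the
  minors of \<open>C\<close> vanish: for \<open>\<J>\<close> from the image of the all-ones matrix, for \<open>\<H>\<close> because the
  \<open>2 \<times> 2\<close> matrix with rows \<open>(a, b)\<close>, \<open>(c, d)\<close> is \<open>\<H>\<close>-related to the one with rows
  \<open>(a b c, a b d)\<close>, \<open>(a c d, b c d)\<close>.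
\<close>

section \<open>Arithmetic in semifields\<close>

subclass (in semifield) semiring_no_zero_divisors_cancel
proof
  have cancel: "a = b" if "a * c = b * c" "c \<noteq> 0" for a b c :: 'a
  proof -
    obtain d where "c * d = 1" using nonzero_has_inverse[OF \<open>c \<noteq> 0\<close>] by blast
    then show ?thesis using that(1) by (metis mult.assoc mult_1_right)
  qed
  show "a * b \<noteq> 0" if "a \<noteq> 0" "b \<noteq> 0" for a b :: 'a
    using that by (rule semifield_mult_nonzero)
  show "a * c = b * c \<longleftrightarrow> c = 0 \<or> a = b" for a b c :: 'a
    using cancel[of a c b] by auto
  show "c * a = c * b \<longleftrightarrow> c = 0 \<or> a = b" for a b c :: 'a
    using cancel[of a c b] by (auto simp: mult.commute[of c])
qed

text \<open>At zero the chosen value is unspecified, so the laws below all carry a nonzero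
  hypothesis.\<close>

definition sinv :: "'s::semifield \<Rightarrow> 's"
  where "sinv a = (SOME b. a * b = 1)"

lemma sinv_right [simp]: "a \<noteq> 0 \<Longrightarrow> a * sinv a = 1"
  unfolding sinv_def by (rule someI_ex) (rule nonzero_has_inverse)

lemma sinv_left [simp]: "a \<noteq> 0 \<Longrightarrow> sinv a * a = 1"
  by (simp add: mult.commute)

lemma sinv_nonzero [simp]: "a \<noteq> 0 \<Longrightarrow> sinv a \<noteq> 0"
  by (metis mult_zero_right sinv_right zero_neq_one)

lemma sinv_mult_cancel: "a \<noteq> 0 \<Longrightarrow> sinv a * (b * a) = b"
  by (subst mult.left_commute) simp

definition zerosumfree :: "'s::semifield itself \<Rightarrow> bool"
  where "zerosumfree _ \<longleftrightarrow> (\<forall>a b :: 's. a + b = 0 \<longrightarrow> a = 0)"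

lemma zerosumfreeD:
  assumes "zerosumfree TYPE('s::semifield)" "(a :: 's) + b = 0"
  shows "a = 0" "b = 0"
  using assms by (auto simp: zerosumfree_def add.commute)

text \<open>Dividing \<open>a + b = 0\<close> by a nonzero \<open>a\<close> gives an element that
  acts as -1. From here on the equation \<open>1 + m = 0\<close> expresses that the semifield is a
  field.\<close>

lemma not_zerosumfree_imp_minus_one:
  assumes "\<not> zerosumfree TYPE('s::semifield)"
  obtains m :: "'s::semifield" where "1 + m = 0"
proof -
  obtain a b :: 's where ab: "a + b = 0" "a \<noteq> 0"
    using assms by (auto simp: zerosumfree_def)
  have "1 + sinv a * b = sinv a * (a + b)" using ab(2) by (simp add: distrib_left)
  then show ?thesis using that ab(1) by simp
qed

lemma zerosumfree_sum_eq_0: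
  fixes f :: "'b \<Rightarrow> 's::semifield"
  assumes "zerosumfree TYPE('s)" "finite I" "sum f I = 0" "i \<in> I"
  shows "f i = 0"
  using assms(2-4)
proof (induction I rule: finite_induct)
  case (insert j I)
  then show ?case using zerosumfreeD[OF assms(1), of "f j" "sum f I"] by auto
qed simp

lemma mat_scale_nth [simp]: "mat_scale s A $ i $ j = s * A $ i $ j"
  by (simp add: mat_scale_def)

lemma mat_scale_mat_scale [simp]:
  "mat_scale s (mat_scale t A) = mat_scale (s * t) (A :: 's::semifield ^ 'n ^ 'm)"
  by (simp add: vec_eq_iff mult.assoc)

lemma mat_scale_1 [simp]: "mat_scale 1 A = (A :: 's::semifield ^ 'n ^ 'm)"
  by (simp add: vec_eq_iff)

lemma mat_scale_0 [simp]: "mat_scale 0 A = (0 :: 's::semifield ^ 'n ^ 'm)"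
  by (simp add: vec_eq_iff)

lemma mat_scale_mult_left:
  "mat_scale s A ** B = mat_scale s (A ** (B :: 's::semifield ^ 'k ^ 'n))"
  by (simp add: vec_eq_iff matrix_matrix_mult_def sum_distrib_left mult_ac)

lemma mat_scale_mult_right:
  "A ** mat_scale s B = mat_scale s (A ** (B :: 's::semifield ^ 'k ^ 'n))"
  by (simp add: vec_eq_iff matrix_matrix_mult_def sum_distrib_left mult_ac)

lemma matrix_add_rdistrib:
  "(A + B) ** C = A ** C + B ** (C :: 's::semifield ^ 'k ^ 'n)"
  by (simp add: vec_eq_iff matrix_matrix_mult_def sum.distrib distrib_right)

lemma mat_scale_add: "mat_scale s (A + B) = mat_scale s A + mat_scale s (B :: 's::semifield ^ 'n ^ 'm)"
  by (simp add: vec_eq_iff distrib_left)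

lemma mat_scale_eq_0_iff [simp]:
  "mat_scale s A = 0 \<longleftrightarrow> s = 0 \<or> A = (0 :: 's::semifield ^ 'n ^ 'm)"
  by (auto simp: vec_eq_iff)

section \<open>Matrices of rank one\<close>

definition outer :: "'s::times ^ 'm \<Rightarrow> 's ^ 'n \<Rightarrow> 's ^ 'n ^ 'm"
  where "outer u v = (\<chi> i j. u $ i * v $ j)"

definition rank1 :: "'s::semifield ^ 'n ^ 'm \<Rightarrow> bool"
  where "rank1 A \<longleftrightarrow> A \<noteq> 0 \<and> (\<exists>u v. A = outer u v)"

definition munit :: "'m \<Rightarrow> 'n \<Rightarrow> 's::semifield ^ 'n ^ 'm"
  where "munit i j = outer (axis i 1) (axis j 1)"

lemma outer_nth [simp]: "outer u v $ i $ j = u $ i * v $ j"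
  by (simp add: outer_def)

lemma axis_nth: "axis i x $ j = (if j = i then x else 0)"
  by (simp add: axis_def)

lemma munit_nth [simp]: "munit i j $ k $ l = (if k = i \<and> l = j then 1 else 0)"
  by (simp add: munit_def axis_nth)

lemma outer_scale_left: "outer (s *s u) v = mat_scale s (outer u (v :: 's::semifield ^ 'n))"
  by (simp add: vec_eq_iff mult.assoc)

lemma outer_scale_right: "outer u (s *s v) = mat_scale s (outer u (v :: 's::semifield ^ 'n))"
  by (simp add: vec_eq_iff mult_ac)

lemma outer_add_left: "outer (u + u') v = outer u v + outer u' (v :: 's::semifield ^ 'n)"
  by (simp add: vec_eq_iff distrib_right)

lemma outer_add_right: "outer u (v + v') = outer u v + outer u (v' :: 's::semifield ^ 'n)"
  by (simp add: vec_eq_iff distrib_left)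

lemma outer_eq_0_iff [simp]:
  "outer u v = 0 \<longleftrightarrow> u = 0 \<or> v = (0 :: 's::semifield ^ 'n)"
  by (auto simp: vec_eq_iff)

lemma mult_outer: "A ** outer u v = outer (A *v u) (v :: 's::semifield ^ 'k)"
  by (simp add: vec_eq_iff matrix_matrix_mult_def matrix_vector_mult_def sum_distrib_right mult.assoc)

lemma outer_mult: "outer u v ** A = outer u ((v :: 's::semifield ^ 'k) v* A)"
  by (simp add: vec_eq_iff matrix_matrix_mult_def vector_matrix_mult_def sum_distrib_left mult.assoc)

lemma munit_mult_nth: "(munit i j ** A) $ k $ l = (if k = i then A $ j $ l else 0)"
  by (simp add: matrix_matrix_mult_def if_distrib if_distribR cong: if_cong)

lemma mult_munit_nth: "(A ** munit i j) $ k $ l = (if l = j then A $ k $ i else 0)"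
  by (simp add: matrix_matrix_mult_def if_distrib if_distribR cong: if_cong)

lemma rank1_outer: "u \<noteq> 0 \<Longrightarrow> v \<noteq> 0 \<Longrightarrow> rank1 (outer u v)"
  by (auto simp: rank1_def)

lemma rank1E:
  assumes "rank1 A"
  obtains u v where "A = outer u v" "u \<noteq> 0" "v \<noteq> 0"
  using assms unfolding rank1_def by (metis outer_eq_0_iff)

text \<open>Minors are compared without subtraction. Conversely, with a nonzero entry at
  \<open>(k, l)\<close> as pivot, column \<open>l\<close> and row \<open>k\<close> divided by the
  pivot are the two factors.\<close>

lemma rank1_iff_minors:
  fixes A :: "'s::semifield ^ 'n ^ 'm"
  shows "rank1 A \<longleftrightarrow> A \<noteq> 0 \<and> (\<forall>i j k l. A $ i $ j * A $ k $ l = A $ i $ l * A $ k $ j)"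
proof (intro iffI conjI)
  assume *: "A \<noteq> 0 \<and> (\<forall>i j k l. A $ i $ j * A $ k $ l = A $ i $ l * A $ k $ j)"
  then obtain k l where kl: "A $ k $ l \<noteq> 0" by (auto simp: vec_eq_iff)
  have "A = outer (\<chi> i. A $ i $ l) (\<chi> j. sinv (A $ k $ l) * A $ k $ j)"
  proof -
    have "A $ i $ j = A $ i $ l * (sinv (A $ k $ l) * A $ k $ j)" for i j
    proof -
      have "A $ i $ j = sinv (A $ k $ l) * (A $ i $ j * A $ k $ l)"
        using kl by (rule sinv_mult_cancel[symmetric])
      also have "A $ i $ j * A $ k $ l = A $ i $ l * A $ k $ j" using * by blast
      finally show ?thesis by (simp only: mult.left_commute)
    qed
    then show ?thesis unfolding vec_eq_iff outer_nth vec_lambda_beta by blast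
  qed
  then show "rank1 A" using * by (auto simp: rank1_def)
next
  assume "rank1 A"
  then show "A \<noteq> 0" by (simp add: rank1_def)
  obtain u v where "A = outer u v" using \<open>rank1 A\<close> by (auto simp: rank1_def)
  then show "\<forall>i j k l. A $ i $ j * A $ k $ l = A $ i $ l * A $ k $ j"
    by (simp add: mult_ac)
qed

lemma rank1_minors: "rank1 A \<Longrightarrow> A $ i $ j * A $ k $ l = A $ i $ l * A $ k $ j"
  using rank1_iff_minors by blast

lemma munit_nonzero [simp]: "munit i j \<noteq> 0"
  by (auto simp: vec_eq_iff munit_def axis_nth)

lemma axis_1_nonzero [simp]: "axis i (1::'s::semifield) \<noteq> 0"
  by (auto simp: vec_eq_iff axis_nth)

lemma rank1_munit [simp]: "rank1 (munit i j)"
  unfolding munit_def by (intro rank1_outer) simp_all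

lemma rank1_mat_scale: "rank1 A \<Longrightarrow> s \<noteq> 0 \<Longrightarrow> rank1 (mat_scale s A)"
  by (metis mat_scale_eq_0_iff outer_scale_left rank1_def)

lemma matrix_munit_expansion:
  fixes A :: "'s::semifield ^ 'n::finite ^ 'm::finite"
  shows "A = (\<Sum>i\<in>UNIV. \<Sum>j\<in>UNIV. mat_scale (A $ i $ j) (munit i j))"
proof -
  have "(\<Sum>j\<in>UNIV. mat_scale (A $ i $ j) (munit i j) $ k $ l) = (if i = k then A $ i $ l else 0)"
    for i k l
    by (cases "i = k") (simp_all add: if_distrib cong: if_cong)
  then have "(\<Sum>i\<in>UNIV. \<Sum>j\<in>UNIV. mat_scale (A $ i $ j) (munit i j)) $ k $ l = A $ k $ l" for k l
    by (simp add: sum_component del: mat_scale_nth munit_nth)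
  then show ?thesis by (simp add: vec_eq_iff)
qed

text \<open>A zero scalar would relate the zero vector to every vector and destroy symmetry.\<close>

definition par :: "'s::semifield ^ 'n \<Rightarrow> 's ^ 'n \<Rightarrow> bool"
  where "par u v \<longleftrightarrow> (\<exists>c. c \<noteq> 0 \<and> u = c *s v)"

lemma equivp_par: "equivp (par :: 's::semifield ^ 'n \<Rightarrow> _)"
proof (rule equivpI)
  show "reflp (par :: 's ^ 'n \<Rightarrow> _)"
    by (auto simp: reflp_def par_def intro!: exI[of _ 1])
  show "symp (par :: 's ^ 'n \<Rightarrow> _)"
  proof (rule sympI)
    fix u v :: "'s ^ 'n" assume "par u v"
    then obtain c where "c \<noteq> 0" "u = c *s v" by (auto simp: par_def)
    then have "sinv c \<noteq> 0 \<and> v = sinv c *s u"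
      by (simp add: vec_eq_iff mult.assoc[symmetric])
    then show "par v u" unfolding par_def by blast
  qed
  show "transp (par :: 's ^ 'n \<Rightarrow> _)"
  proof (rule transpI)
    fix u v w :: "'s ^ 'n" assume "par u v" "par v w"
    then obtain c d where "c \<noteq> 0" "u = c *s v" "d \<noteq> 0" "v = d *s w" by (auto simp: par_def)
    then have "c * d \<noteq> 0 \<and> u = (c * d) *s w" by (simp add: vec_eq_iff mult.assoc)
    then show "par u w" unfolding par_def by blast
  qed
qed

lemma par_if_cross_eq:
  fixes u v :: "'s::semifield ^ 'n"
  assumes "u \<noteq> 0" "v \<noteq> 0" "\<And>i k. u $ i * v $ k = u $ k * v $ i"
  shows "par u v"
proof -
  obtain k where k: "v $ k \<noteq> 0" using assms(2) by (auto simp: vec_eq_iff)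
  obtain i where i: "u $ i \<noteq> 0" using assms(1) by (auto simp: vec_eq_iff)
  \<comment> \<open>The cross equation carries this nonzero product to \<open>u $ k * v $ i\<close>,
    so \<open>k\<close> is a pivot for both vectors.\<close>
  have "u $ i * v $ k \<noteq> 0" using i k by simp
  then have "u $ k \<noteq> 0" unfolding assms(3)[of i k] by auto
  have "u $ j = (sinv (v $ k) * u $ k) * v $ j" for j
  proof -
    have "u $ j = sinv (v $ k) * (u $ j * v $ k)"
      using k by (rule sinv_mult_cancel[symmetric])
    also have "u $ j * v $ k = u $ k * v $ j" by (rule assms(3))
    finally show ?thesis by (simp only: mult.assoc)
  qed
  then have "u = (sinv (v $ k) * u $ k) *s v" unfolding vec_eq_iff vector_smult_component by blast
  moreover have "sinv (v $ k) * u $ k \<noteq> 0" using k \<open>u $ k \<noteq> 0\<close> by simp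
  ultimately show ?thesis unfolding par_def by blast
qed

section \<open>Two equivalence relations on a grid\<close>

text \<open>If \<open>L\<close> misses \<open>a, b\<close> and \<open>R\<close> misses
  \<open>c, d\<close>, then \<open>R a b\<close> and \<open>L c d\<close> hold. However
  \<open>a, b\<close> are then related to \<open>c, d\<close>, transitivity supplies one of the
  missing pairs.\<close>

lemma two_equivs_cover:
  assumes "equivp L" "equivp R" "\<And>a b. a \<in> S \<Longrightarrow> b \<in> S \<Longrightarrow> L a b \<or> R a b"
  shows "(\<forall>a\<in>S. \<forall>b\<in>S. L a b) \<or> (\<forall>a\<in>S. \<forall>b\<in>S. R a b)"
proof (rule ccontr)
  assume "\<not> ?thesis"
  then obtain a b c d where *: "a \<in> S" "b \<in> S" "\<not> L a b" "c \<in> S" "d \<in> S" "\<not> R c d"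
    by blast
  then have "R a b" "L c d" using assms(3) by blast+
  moreover have "L x y \<or> R x y" if "x \<in> {a,b}" "y \<in> {c,d}" for x y using that * assms(3) by blast
  ultimately show False using * equivp_transp[OF assms(1)] equivp_transp[OF assms(2)]
      equivp_symp[OF assms(1)] equivp_symp[OF assms(2)] by (smt (verit) insertCI)
qed

text \<open>Each row is of one type by \<open>two_equivs_cover\<close>. An \<open>R\<close> row
  \<open>i\<close> and an \<open>L\<close> row \<open>k\<close> cannot coexist: of their links in
  two columns, equal types contradict the type of one row, and mixed types relate two cells of
  different rows by both relations.\<close>

lemma grid_lines_uniform:
  fixes L R :: "'n \<times> 'n \<Rightarrow> 'n \<times> 'n \<Rightarrow> bool"
  assumes "equivp L" "equivp R"
    and "\<And>i j k. L (i,j) (i,k) \<or> R (i,j) (i,k)"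
    and "\<And>i j k. L (i,j) (k,j) \<or> R (i,j) (k,j)"
    and "\<And>p q. L p q \<Longrightarrow> R p q \<Longrightarrow> p = q"
  shows "(\<forall>i j k. L (i,j) (i,k)) \<or> (\<forall>i j k. R (i,j) (i,k))"
proof (rule ccontr)
  assume "\<not> ?thesis"
  then obtain i a b k c d where *: "\<not> L (i,a) (i,b)" "\<not> R (k,c) (k,d)"
    by blast
  have row: "(\<forall>a b. L (i,a) (i,b)) \<or> (\<forall>a b. R (i,a) (i,b))" for i
    using two_equivs_cover[OF assms(1,2), of "{i} \<times> UNIV"] assms(3) by auto
  have R: "R (i,x) (i,y)" for x y using row[of i] * by blast
  have L: "L (k,x) (k,y)" for x y using row[of k] * by blast
  have "a \<noteq> b" using * assms(1) by (metis equivp_reflp)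
  then have ne: "\<not> R (k,a) (k,b)" "\<not> L (i,a) (i,b)" using L R assms(5) by blast+
  have "i \<noteq> k" using * R by blast
  have tr: "L p q \<Longrightarrow> L q r \<Longrightarrow> L p r" "R p q \<Longrightarrow> R q r \<Longrightarrow> R p r"
    "L p q \<Longrightarrow> L q p" "R p q \<Longrightarrow> R q p" for p q r
    using equivp_transp[OF assms(1)] equivp_transp[OF assms(2)]
      equivp_symp[OF assms(1)] equivp_symp[OF assms(2)] by blast+
  have "L (i,a) (k,a) \<or> R (i,a) (k,a)" "L (i,b) (k,b) \<or> R (i,b) (k,b)"
    using assms(4) by blast+
  moreover have False if "L (i,a) (k,a)" "L (i,b) (k,b)"
    using tr(1)[OF that(1) tr(1)[OF L tr(3)[OF that(2)]]] ne by blast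
  moreover have False if "R (i,a) (k,a)" "R (i,b) (k,b)"
    using tr(2)[OF tr(4)[OF that(1)] tr(2)[OF R that(2)]] ne by blast
  \<comment> \<open>The \<open>L\<close> path runs along row \<open>k\<close>, the \<open>R\<close>
    path along row \<open>i\<close>; both join \<open>(i,x)\<close> to \<open>(k,y)\<close>.\<close>
  moreover have False if h: "L (i,x) (k,x)" "R (i,y) (k,y)" for x y
  proof -
    have "L (i,x) (k,y)" by (rule tr(1)[OF h(1) L])
    moreover have "R (i,x) (k,y)" by (rule tr(2)[OF R h(2)])
    ultimately show False using assms(5) \<open>i \<noteq> k\<close> by blast
  qed
  ultimately show False by blast
qed

section \<open>Linear maps given by scaled outer products\<close>

lemma mat_linear_add: "mat_linear T \<Longrightarrow> T (A + B) = T A + T B"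
  by (simp add: mat_linear_def)

lemma mat_linear_scale: "mat_linear T \<Longrightarrow> T (mat_scale s A) = mat_scale s (T A)"
  by (simp add: mat_linear_def)

lemma mat_linear_0: "mat_linear T \<Longrightarrow> T 0 = 0"
  using mat_linear_scale[of T 0 0] by simp

lemma mat_linear_sum: "mat_linear T \<Longrightarrow> T (sum f I) = (\<Sum>i\<in>I. T (f i))"
  by (induction I rule: infinite_finite_induct) (simp_all add: mat_linear_0 mat_linear_add)

lemma mat_linear_eq_0_iff: "mat_linear T \<Longrightarrow> bij T \<Longrightarrow> T A = 0 \<longleftrightarrow> A = 0"
  by (metis mat_linear_0 bij_is_inj injD)

lemma mat_linear_munit_expansion:
  fixes T :: "'s::semifield ^ 'n::finite ^ 'n \<Rightarrow> 's ^ 'n ^ 'n"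
  assumes "mat_linear T"
  shows "T A = (\<Sum>i\<in>UNIV. \<Sum>j\<in>UNIV. mat_scale (A $ i $ j) (T (munit i j)))"
  by (subst matrix_munit_expansion[of A])
    (simp only: mat_linear_sum[OF assms] mat_linear_scale[OF assms])

lemma mat_linear_inv:
  assumes "bij T" "mat_linear T"
  shows "mat_linear (inv T)"
  unfolding mat_linear_def
proof (intro conjI allI)
  have *: "T (inv T A) = A" "inv T (T A) = A" for A
    using assms(1) by (simp_all add: bij_is_inj bij_is_surj surj_f_inv_f)
  show "inv T (A + B) = inv T A + inv T B" for A B
    using mat_linear_add[OF assms(2), of "inv T A" "inv T B"] * by metis
  show "inv T (mat_scale s A) = mat_scale s (inv T A)" for s A
    using mat_linear_scale[OF assms(2), of s "inv T A"] * by metis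
qed

definition hadamard :: "'s::times ^ 'n ^ 'm \<Rightarrow> 's ^ 'n ^ 'm \<Rightarrow> 's ^ 'n ^ 'm"
  where "hadamard C A = (\<chi> i j. C $ i $ j * A $ i $ j)"

lemma hadamard_nth [simp]: "hadamard C A $ i $ j = C $ i $ j * A $ i $ j"
  by (simp add: hadamard_def)

text \<open>Left factors depend only on the row and right factors only on the column, so the double
  sum over matrix units is a matrix product with the \<open>x i\<close> as columns on the left and
  the \<open>y j\<close> as rows on the right.\<close>

lemma mult_hadamard_mult_eq:
  fixes T :: "'s::semifield ^ 'n::finite ^ 'n \<Rightarrow> 's ^ 'n ^ 'n"
  assumes "mat_linear T" "\<And>i j. T (munit i j) = mat_scale (C $ i $ j) (outer (x i) (y j))"
  shows "T A = (\<chi> r i. x i $ r) ** hadamard C A ** (\<chi> j s. y j $ s)"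
proof -
  have "T A $ r $ s = (\<Sum>j\<in>UNIV. \<Sum>i\<in>UNIV. A $ i $ j * (C $ i $ j * (x i $ r * y j $ s)))" for r s
    by (subst mat_linear_munit_expansion[OF assms(1)], subst sum.swap)
      (simp add: assms(2) sum_component mult.assoc)
  then show ?thesis
    by (simp add: vec_eq_iff matrix_matrix_mult_def sum_distrib_left sum_distrib_right mult_ac)
qed

text \<open>A preimage of the identity gives one-sided inverses, and injectivity makes them
  two-sided; no determinant is involved.\<close>

lemma bij_mult_imp_invertible:
  fixes P Q :: "'s::semifield ^ 'n::finite ^ 'n"
  assumes "bij (\<lambda>A. P ** A ** Q)"
  shows "invertible P" "invertible Q"
proof -
  obtain X where X: "P ** X ** Q = mat 1"
    using surjD[OF bij_is_surj[OF assms], of "mat 1"] by metis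
  have inj: "A = B" if "P ** A ** Q = P ** B ** Q" for A B
    by (rule injD[OF bij_is_inj[OF assms]]) (rule that)
  have 1: "P ** (X ** Q) = mat 1" using X by (simp add: matrix_mul_assoc)
  have "P ** ((X ** Q) ** P) ** Q = P ** mat 1 ** Q" using 1 by (simp add: matrix_mul_assoc)
  then have "(X ** Q) ** P = mat 1" by (rule inj)
  with 1 show "invertible P" unfolding invertible_def by blast
  have "P ** (Q ** (P ** X)) ** Q = P ** mat 1 ** Q"
    using X by (metis matrix_mul_assoc matrix_mul_rid)
  then have "Q ** (P ** X) = mat 1" by (rule inj)
  with X show "invertible Q" unfolding invertible_def by blast
qed

lemma bij_transpose: "bij (transpose :: 's ^ 'n ^ 'n \<Rightarrow> _)"
  by (rule involuntory_imp_bij) simp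

lemma mat_linear_transpose: "mat_linear transpose"
  by (simp add: mat_linear_def transpose_def vec_eq_iff)

lemma mat_linear_comp: "mat_linear S \<Longrightarrow> mat_linear T \<Longrightarrow> mat_linear (S \<circ> T)"
  by (simp add: mat_linear_def)

lemma bij_hadamard:
  assumes "\<And>i j. C $ i $ j \<noteq> (0 :: 's::semifield)"
  shows "bij (hadamard C :: 's ^ 'n ^ 'm \<Rightarrow> _)"
proof (rule o_bij)
  define D :: "'s ^ 'n ^ 'm" where "D = (\<chi> i j. sinv (C $ i $ j))"
  show "hadamard D \<circ> hadamard C = id" "hadamard C \<circ> hadamard D = id"
    using assms by (simp_all add: fun_eq_iff vec_eq_iff D_def mult.assoc[symmetric])
qed

text \<open>An intermediate normal form: \<open>C\<close> still has to be absorbed into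
  \<open>P\<close> and \<open>Q\<close>, and \<open>F\<close> records whether a transposition
  occurs.\<close>

definition mult_hadamard_form ::
    "('s::semifield ^ 'n::finite ^ 'n \<Rightarrow> 's ^ 'n ^ 'n) \<Rightarrow> 's ^ 'n ^ 'n \<Rightarrow> 's ^ 'n ^ 'n \<Rightarrow> 's ^ 'n ^ 'n \<Rightarrow> bool"
  where "mult_hadamard_form T P C Q \<longleftrightarrow> invertible P \<and> invertible Q \<and> (\<forall>i j. C $ i $ j \<noteq> 0) \<and>
    (\<exists>F. (F = id \<or> F = transpose) \<and> (\<forall>A. T A = P ** hadamard C (F A) ** Q))"

lemma mult_hadamard_form_aligned:
  fixes T :: "'s::semifield ^ 'n::finite ^ 'n \<Rightarrow> 's ^ 'n ^ 'n"
  assumes "bij T" "mat_linear T"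
    and T: "\<And>i j. T (munit i j) = outer (x i j) (y i j)"
    and rows: "\<And>i j k. par (x i j) (x i k)"
    and cols: "\<And>i j k. par (y i j) (y k j)"
  shows "\<exists>P C Q. invertible P \<and> invertible Q \<and> (\<forall>i j. C $ i $ j \<noteq> 0) \<and>
    (\<forall>A. T A = P ** hadamard C A ** Q)"
proof -
  \<comment> \<open>An arbitrary index: column \<open>z\<close> supplies the reference left factors,
    row \<open>z\<close> the reference right factors.\<close>
  obtain z :: 'n where True by blast
  have "\<exists>c. c \<noteq> 0 \<and> x i j = c *s x i z" for i j using rows by (auto simp: par_def)
  then obtain c where c: "\<And>i j. c i j \<noteq> 0" "\<And>i j. x i j = c i j *s x i z" by metis
  have "\<exists>d. d \<noteq> 0 \<and> y i j = d *s y z j" for i j using cols by (auto simp: par_def)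
  then obtain d where d: "\<And>i j. d i j \<noteq> 0" "\<And>i j. y i j = d i j *s y z j" by metis
  define C where "C = (\<chi> i j. c i j * d i j)"
  have "T (munit i j) = mat_scale (C $ i $ j) (outer (x i z) (y z j))" for i j
    unfolding T by (subst c(2), subst d(2)) (simp add: outer_scale_left outer_scale_right C_def mult.commute)
  note form = mult_hadamard_mult_eq[where x = "\<lambda>i. x i z" and y = "y z", OF assms(2) this]
  have C: "C $ i $ j \<noteq> 0" for i j by (simp add: C_def c d)
  let ?P = "\<chi> r i. x i z $ r" and ?Q = "\<chi> j s. y z j $ s"
  \<comment> \<open>Undoing the entrywise product leaves a bijection of the form
    \<open>P ** A ** Q\<close>, which makes both factors invertible.\<close>
  have "T \<circ> inv (hadamard C) = (\<lambda>A. ?P ** A ** ?Q)"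
    by (simp add: fun_eq_iff form surj_f_inv_f bij_is_surj bij_hadamard C)
  moreover have "bij (T \<circ> inv (hadamard C))"
    using assms(1) C by (intro bij_comp bij_imp_bij_inv bij_hadamard) auto
  ultimately have "bij (\<lambda>A. ?P ** A ** ?Q)" by simp
  from bij_mult_imp_invertible[OF this] form C show ?thesis by blast
qed

text \<open>Rows and columns are each of one type. Opposite types give the aligned form, directly or
  after transposition. Equal types would put a common factor into all images, which is possible only
  for a single index.\<close>

lemma bij_linear_mult_hadamard_form:
  fixes T :: "'s::semifield ^ 'n::finite ^ 'n \<Rightarrow> 's ^ 'n ^ 'n"
  assumes "bij T" "mat_linear T"
    and T: "\<And>i j. T (munit i j) = outer (x i j) (y i j)"
    and rows: "\<And>i j k. par (x i j) (x i k) \<or> par (y i j) (y i k)"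
    and cols: "\<And>i j k. par (x i j) (x k j) \<or> par (y i j) (y k j)"
  obtains P C Q where "mult_hadamard_form T P C Q"
proof -
  note form = that
  define L where "L p q = par (x (fst p) (snd p)) (x (fst q) (snd q))" for p q
  define R where "R p q = par (y (fst p) (snd p)) (y (fst q) (snd q))" for p q
  have eq: "equivp L" "equivp R"
    using equivp_par[where 's='s and 'n='n] unfolding L_def R_def equivp_def fun_eq_iff by metis+
  \<comment> \<open>If both factors are proportional, so are the images, and injectivity identifies
    the matrix units.\<close>
  have LR: "p = q" if "L p q" "R p q" for p q
  proof -
    obtain i j k l where [simp]: "p = (i, j)" "q = (k, l)" by (cases p, cases q)
    have "par (x i j) (x k l)" "par (y i j) (y k l)" using that by (simp_all add: L_def R_def)
    then obtain c d where "x i j = c *s x k l" "y i j = d *s y k l" unfolding par_def by blast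
    then have "T (munit i j) = T (mat_scale (c * d) (munit k l))"
      by (simp add: T mat_linear_scale[OF assms(2)] outer_scale_left outer_scale_right mult.commute)
    then have "munit i j = mat_scale (c * d) (munit k l :: 's ^ 'n ^ 'n)"
      by (rule injD[OF bij_is_inj[OF assms(1)]])
    then have "munit i j $ i $ j = mat_scale (c * d) (munit k l :: 's ^ 'n ^ 'n) $ i $ j" by metis
    then show ?thesis by (auto split: if_splits)
  qed
  have rows': "(\<forall>i j k. L (i,j) (i,k)) \<or> (\<forall>i j k. R (i,j) (i,k))"
    by (rule grid_lines_uniform[OF eq]) (use rows cols LR in \<open>auto simp: L_def R_def\<close>)
  \<comment> \<open>Swapping coordinates turns columns into rows, so the same grid lemma
    applies.\<close>
  let ?L' = "\<lambda>p q. L (prod.swap p) (prod.swap q)" and ?R' = "\<lambda>p q. R (prod.swap p) (prod.swap q)"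
  have cols': "(\<forall>i j k. ?L' (i,j) (i,k)) \<or> (\<forall>i j k. ?R' (i,j) (i,k))"
  proof (rule grid_lines_uniform)
    show "equivp ?L'" "equivp ?R'" using eq unfolding equivp_def fun_eq_iff by metis+
    show "?L' p q \<Longrightarrow> ?R' p q \<Longrightarrow> p = q" for p q using LR by (metis swap_swap)
  qed (use rows cols in \<open>auto simp: L_def R_def\<close>)
  \<comment> \<open>With a shared factor in all images, the identity matrix would be an outer
    product.\<close>
  have trivial: "i = j" if "\<And>A. \<exists>u. T A = outer u v \<or> T A = outer w u" for i j :: 'n and v w
  proof (rule ccontr)
    assume "i \<noteq> j"
    obtain A where "T A = mat 1" using surjD[OF bij_is_surj[OF assms(1)], of "mat 1"] by metis
    with that[of A] obtain u v :: "'s ^ 'n" where uv: "outer u v = mat 1" by metis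
    have m: "u $ k * v $ l = (if k = l then 1 else 0)" for k l
      using arg_cong[OF uv, of "\<lambda>M. M $ k $ l"] by (simp add: mat_def)
    have "u $ i \<noteq> 0" "v $ j \<noteq> 0" using m[of i i] m[of j j] by auto
    then show False using m[of i j] \<open>i \<noteq> j\<close> by simp
  qed
  have aligned: thesis if LR: "\<And>i j k. L (i,j) (i,k)" "\<And>i j k. R (j,i) (k,i)"
  proof -
    have "\<exists>P C Q. invertible P \<and> invertible Q \<and> (\<forall>i j. C $ i $ j \<noteq> 0) \<and>
        (\<forall>A. T A = P ** hadamard C A ** Q)"
      by (rule mult_hadamard_form_aligned[OF assms(1,2) T]) (use LR in \<open>simp_all add: L_def R_def\<close>)
    then obtain P C Q where "mult_hadamard_form T P C Q"
      unfolding mult_hadamard_form_def by (metis id_apply)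
    then show thesis by (rule form)
  qed
  obtain z :: 'n where True by blast
  consider (LR) "\<And>i j k. L (i,j) (i,k)" "\<And>i j k. R (j,i) (k,i)"
    | (RL) "\<And>i j k. R (i,j) (i,k)" "\<And>i j k. L (j,i) (k,i)"
    | (LL) "\<And>i j k. L (i,j) (i,k)" "\<And>i j k. L (j,i) (k,i)"
    | (RR) "\<And>i j k. R (i,j) (i,k)" "\<And>i j k. R (j,i) (k,i)"
    using rows' cols' by auto
  then show thesis
  proof cases
    case LR
    then show thesis by (rule aligned)
  next
    case RL
    have "(T \<circ> transpose) (munit i j) = outer (x j i) (y j i)" for i j
    proof -
      have "transpose (munit i j :: 's ^ 'n ^ 'n) = munit j i"
        by (auto simp: transpose_def vec_eq_iff)
      then show ?thesis by (simp add: T)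
    qed
    moreover have "bij (T \<circ> transpose)" "mat_linear (T \<circ> transpose)"
      using assms bij_transpose mat_linear_transpose by (auto intro: bij_comp mat_linear_comp)
    ultimately have "\<exists>P C Q. invertible P \<and> invertible Q \<and> (\<forall>i j. C $ i $ j \<noteq> 0) \<and>
        (\<forall>A. (T \<circ> transpose) A = P ** hadamard C A ** Q)"
      by (intro mult_hadamard_form_aligned[of "T \<circ> transpose" "\<lambda>i j. x j i" "\<lambda>i j. y j i"])
        (use RL in \<open>simp_all add: L_def R_def\<close>)
    then obtain P C Q where *: "invertible P" "invertible Q" "\<And>i j. C $ i $ j \<noteq> 0"
      "\<And>A. (T \<circ> transpose) A = P ** hadamard C A ** Q" by blast
    have "T A = P ** hadamard C (transpose A) ** Q" for A
      using *(4)[of "transpose A"] by simp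
    with * have "mult_hadamard_form T P C Q"
      unfolding mult_hadamard_form_def by auto
    then show ?thesis by (rule that)
  next
    case LL
    have "L (i,j) (z,z)" for i j
      using LL equivp_transp[OF eq(1)] by blast
    then have "\<exists>c. x i j = c *s x z z" for i j by (auto simp: L_def par_def)
    then obtain c where c: "\<And>i j. x i j = c i j *s x z z" by metis
    have "T A = outer (x z z) (\<Sum>i\<in>UNIV. \<Sum>j\<in>UNIV. (A $ i $ j * c i j) *s y i j)" for A
      by (subst mat_linear_munit_expansion[OF assms(2)], unfold T, subst c)
        (simp add: vec_eq_iff sum_component sum_distrib_left mult_ac)
    then have "i = j" for i j :: 'n using trivial by blast
    then have "L (i,j) (i,k)" "R (j,i) (k,i)" for i j k using equivp_reflp[OF eq(1)] equivp_reflp[OF eq(2)] by metis+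
    then show ?thesis by (rule aligned)
  next
    case RR
    have "R (i,j) (z,z)" for i j
      using RR equivp_transp[OF eq(2)] by blast
    then have "\<exists>c. y i j = c *s y z z" for i j by (auto simp: R_def par_def)
    then obtain c where c: "\<And>i j. y i j = c i j *s y z z" by metis
    have "T A = outer (\<Sum>i\<in>UNIV. \<Sum>j\<in>UNIV. (A $ i $ j * c i j) *s x i j) (y z z)" for A
      by (subst mat_linear_munit_expansion[OF assms(2)], unfold T, subst c)
        (simp add: vec_eq_iff sum_component sum_distrib_left sum_distrib_right mult_ac)
    then have "i = j" for i j :: 'n using trivial by blast
    then have "L (i,j) (i,k)" "R (j,i) (k,i)" for i j k using equivp_reflp[OF eq(1)] equivp_reflp[OF eq(2)] by metis+
    then show ?thesis by (rule aligned)
  qed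
qed

text \<open>An entrywise product with \<open>outer a b\<close> scales rows by \<open>a\<close> and
  columns by \<open>b\<close>, that is, it multiplies by diagonal matrices on both sides; these
  merge with \<open>P\<close> and \<open>Q\<close>.\<close>

lemma mult_hadamard_form_rank1:
  fixes T :: "'s::semifield ^ 'n::finite ^ 'n \<Rightarrow> 's ^ 'n ^ 'n"
  assumes "bij T" "mult_hadamard_form T P C Q" "rank1 C"
  shows "\<exists>P Q. invertible P \<and> invertible Q \<and>
    ((\<forall>A. T A = P ** A ** Q) \<or> (\<forall>A. T A = P ** transpose A ** Q))"
proof -
  obtain a b where C: "C = outer a b" using assms(3) by (rule rank1E)
  obtain F where F: "F = id \<or> F = transpose" "\<And>A. T A = P ** hadamard C (F A) ** Q"
    using assms(2) unfolding mult_hadamard_form_def by blast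
  define P' where "P' = (\<chi> r i. P $ r $ i * a $ i)"
  define Q' where "Q' = (\<chi> j s. b $ j * Q $ j $ s)"
  have "P ** hadamard C A ** Q = P' ** A ** Q'" for A
    by (simp add: vec_eq_iff matrix_matrix_mult_def P'_def Q'_def C sum_distrib_left sum_distrib_right mult_ac)
  with F(2) have T: "T A = P' ** F A ** Q'" for A by simp
  have "bij F" using F(1) by (elim disjE) (simp_all add: bij_transpose)
  have "F \<circ> F = id" using F(1) by (auto simp: fun_eq_iff)
  then have "(\<lambda>A. P' ** A ** Q') = T \<circ> F" by (simp add: fun_eq_iff T pointfree_idE)
  moreover have "bij (T \<circ> F)" using assms(1) \<open>bij F\<close> by (intro bij_comp)
  ultimately have "bij (\<lambda>A. P' ** A ** Q')" by metis
  from bij_mult_imp_invertible[OF this] have "invertible P'" "invertible Q'" .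
  then show ?thesis using T F(1) by (metis id_apply)
qed

section \<open>Zerosumfree semifields\<close>

lemma munit_eq_scale_munit_iff:
  assumes "mat_scale s (munit i j) = mat_scale t (munit k l)" "s \<noteq> 0"
  shows "i = k" "j = l"
  using arg_cong[OF assms(1), of "\<lambda>M. M $ i $ j"] assms(2) by (auto split: if_splits)

text \<open>Nothing cancels: if \<open>T B\<close> is a matrix unit and \<open>B $ i $ j\<close> is
  nonzero, the image of \<open>munit i j\<close> is supported in the same cell. Choosing such an
  \<open>(i, j)\<close> for every cell is an injective map on a finite set of cells, hence reaches
  every matrix unit.\<close>

lemma zerosumfree_mat_linear_munit:
  fixes T :: "'s::semifield ^ 'n::finite ^ 'n \<Rightarrow> 's ^ 'n ^ 'n"
  assumes zsf: "zerosumfree TYPE('s)" and "bij T" "mat_linear T"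
  obtains s k l where "\<And>i j. s i j \<noteq> 0" "\<And>i j. T (munit i j) = mat_scale (s i j) (munit (k i j) (l i j))"
proof -
  have "\<exists>p s. s \<noteq> 0 \<and> T (munit (fst p) (snd p)) = mat_scale s (munit k l)" for k l
  proof -
    obtain B where B: "T B = munit k l" using surjD[OF bij_is_surj[OF assms(2)], of "munit k l"] by metis
    have "B \<noteq> 0" using B mat_linear_0[OF assms(3)] munit_nonzero by metis
    then obtain i j where ij: "B $ i $ j \<noteq> 0" by (auto simp: vec_eq_iff)
    have "T (munit i j) $ r $ q = 0" if "\<not> (r = k \<and> q = l)" for r q
    proof -
      have "(\<Sum>a\<in>UNIV. \<Sum>b\<in>UNIV. B $ a $ b * T (munit a b) $ r $ q) = T B $ r $ q"
        by (subst mat_linear_munit_expansion[OF assms(3)]) (simp add: sum_component)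
      also have "\<dots> = 0" using that by (simp add: B)
      finally have "(\<Sum>b\<in>UNIV. B $ i $ b * T (munit i b) $ r $ q) = 0"
        using zerosumfree_sum_eq_0[OF zsf finite, of "\<lambda>a. \<Sum>b\<in>UNIV. B $ a $ b * T (munit a b) $ r $ q" UNIV i]
        by simp
      then have "B $ i $ j * T (munit i j) $ r $ q = 0"
        using zerosumfree_sum_eq_0[OF zsf finite, of "\<lambda>b. B $ i $ b * T (munit i b) $ r $ q" UNIV j]
        by simp
      then show ?thesis using ij by simp
    qed
    then have *: "T (munit i j) = mat_scale (T (munit i j) $ k $ l) (munit k l)"
      by (simp add: vec_eq_iff)
    moreover have "T (munit i j) \<noteq> 0" using mat_linear_eq_0_iff[OF assms(3,2)] by simp
    ultimately have "T (munit i j) $ k $ l \<noteq> 0" by (metis mat_scale_0)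
    with * show ?thesis by (intro exI[of _ "(i, j)"]) auto
  qed
  then obtain p s where p: "\<And>k l. s k l \<noteq> 0"
    "\<And>k l. T (munit (fst (p k l)) (snd (p k l))) = mat_scale (s k l) (munit k l)" by metis
  let ?p = "\<lambda>q. p (fst q) (snd q)"
  have "inj ?p"
  proof (rule injI)
    fix q q' assume "?p q = ?p q'"
    then have "mat_scale (s (fst q) (snd q)) (munit (fst q) (snd q))
      = mat_scale (s (fst q') (snd q')) (munit (fst q') (snd q') :: 's ^ 'n ^ 'n)"
      by (metis p(2))
    from munit_eq_scale_munit_iff[OF this p(1)] show "q = q'" by (simp add: prod_eq_iff)
  qed
  then have surj: "surj ?p" by (rule finite_UNIV_inj_surj[OF finite])
  have "\<exists>s k l. s \<noteq> 0 \<and> T (munit i j) = mat_scale s (munit k l)" for i j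
  proof -
    obtain q where "(i, j) = ?p q" using surjD[OF surj] by blast
    then show ?thesis using p by (metis fst_conv snd_conv)
  qed
  then show ?thesis using that by metis
qed

section \<open>Relation H and matrices of rank one\<close>

text \<open>Left multiples of an outer product keep its right factor, right multiples its left
  factor. A matrix that is both keeps the two factors up to a scalar.\<close>

lemma green_H_rank1_imp_scale:
  assumes "green_H A B" "rank1 A"
  shows "\<exists>s. B = mat_scale s A"
proof -
  obtain u v where A: "A = outer u v" "u \<noteq> 0" using assms(2) by (rule rank1E)
  obtain X Y where B: "B = X ** A" "B = A ** Y"
    using assms(1) unfolding green_H_def leq_H_def leq_L_def leq_R_def by blast
  obtain u' v' where B': "B = outer u' v" "B = outer u v'"
    using B unfolding A(1) mult_outer outer_mult by blast
  obtain i where i: "u $ i \<noteq> 0" using A(2) by (auto simp: vec_eq_iff)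
  have "B $ r $ q = (sinv (u $ i) * u' $ i) * A $ r $ q" for r q
  proof -
    have "v' $ q = sinv (u $ i) * (v' $ q * u $ i)" by (rule sinv_mult_cancel[OF i, symmetric])
    also have "v' $ q * u $ i = u' $ i * v $ q"
      using arg_cong[OF B'(1)[unfolded B'(2)], of "\<lambda>M. M $ i $ q"] by (simp add: mult.commute)
    finally have "u $ r * v' $ q = u $ r * (sinv (u $ i) * (u' $ i * v $ q))" by simp
    then show ?thesis unfolding B'(2) A(1) by (simp add: mult_ac)
  qed
  then have "B = mat_scale (sinv (u $ i) * u' $ i) A" unfolding vec_eq_iff mat_scale_nth by blast
  then show ?thesis ..
qed

lemma preserves_green_H_rank1:
  assumes "bij T" "mat_linear T" "preserves T green_H" "rank1 (T A)" "green_H A B"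
  shows "\<exists>s. B = mat_scale s A"
proof -
  have "green_H (T A) (T B)" using assms(3,5) by (simp add: preserves_def)
  then obtain s where "T B = mat_scale s (T A)" using green_H_rank1_imp_scale assms(4) by blast
  then have "T B = T (mat_scale s A)" by (simp add: mat_linear_scale[OF assms(2)])
  then show ?thesis using injD[OF bij_is_inj[OF assms(1)]] by blast
qed

section \<open>Arithmetic with an element acting as minus one\<close>

lemma minus_one_add:
  fixes m x :: "'s::semifield"
  assumes "1 + m = 0"
  shows "x + m * x = 0" "m * x + x = 0"
  using assms by (metis add.commute distrib_right mult_1_left mult_zero_left)+

lemma minus_one_add_cancel:
  fixes m a b c :: "'s::semifield"
  assumes "1 + m = 0"
  shows "a + b = a + c \<longleftrightarrow> b = c"
proof
  assume "a + b = a + c"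
  then have "(m * a + a) + b = (m * a + a) + c" by (simp add: add.assoc)
  then show "b = c" by (simp add: minus_one_add[OF assms])
qed simp

lemma minus_one_eq_iff:
  fixes m a b :: "'s::semifield"
  assumes "1 + m = 0"
  shows "a + m * b = 0 \<longleftrightarrow> a = b"
proof
  assume "a + m * b = 0"
  then have "m * b + a = m * b + b" by (simp add: minus_one_add[OF assms] add.commute)
  then show "a = b" by (simp add: minus_one_add_cancel[OF assms])
qed (simp add: minus_one_add[OF assms])

lemma minus_one_square:
  fixes m :: "'s::semifield"
  assumes "1 + m = 0"
  shows "m * m = 1"
  using minus_one_eq_iff[OF assms, of 1 "m * m"] minus_one_add[OF assms, of m]
    minus_one_eq_iff[OF assms, of "m * m" 1] by (simp add: add.commute)

text \<open>The hypothesis is \<open>(a - b) * (c - d) = 0\<close> with the negative terms moved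
  across.\<close>

lemma minus_one_cross_eq:
  fixes m a b c d :: "'s::semifield"
  assumes m: "1 + m = 0" and "a * c + b * d = a * d + b * c"
  shows "a = b \<or> c = d"
proof -
  have "(a + m * b) * (c + m * d) = (a * c + (m * m) * (b * d)) + m * (a * d + b * c)"
    by (simp add: distrib_left distrib_right ac_simps)
  then have "(a + m * b) * (c + m * d) = 0"
    by (simp add: minus_one_square[OF m] assms(2) minus_one_add[OF m])
  then show ?thesis by (simp add: minus_one_eq_iff[OF m])
qed

text \<open>A minor of the sum factors as a minor of the pair \<open>a, c\<close> times a minor of
  the pair \<open>b, d\<close>.\<close>

lemma rank1_outer_add_outer_imp_par:
  fixes a b c d :: "'s::semifield ^ 'n"
  assumes m: "1 + m = (0 :: 's)"
    and nz: "a \<noteq> 0" "b \<noteq> 0" "c \<noteq> 0" "d \<noteq> 0" and "rank1 (outer a b + outer c d)"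
  shows "par a c \<or> par b d"
proof -
  have "a $ i * c $ k = a $ k * c $ i \<or> b $ j * d $ l = b $ l * d $ j" for i j k l
  proof (rule minus_one_cross_eq[OF m])
    let ?p = "a $ i * b $ j * a $ k * b $ l + c $ i * d $ j * c $ k * d $ l"
    have "(a $ i * b $ j + c $ i * d $ j) * (a $ k * b $ l + c $ k * d $ l)
        = (a $ i * b $ l + c $ i * d $ l) * (a $ k * b $ j + c $ k * d $ j)"
      using rank1_minors[OF assms(6), of i j k l] by simp
    then have "?p + (a $ i * c $ k * (b $ j * d $ l) + a $ k * c $ i * (b $ l * d $ j))
        = ?p + (a $ i * c $ k * (b $ l * d $ j) + a $ k * c $ i * (b $ j * d $ l))"
      by (simp add: distrib_left distrib_right ac_simps)
    then show "a $ i * c $ k * (b $ j * d $ l) + a $ k * c $ i * (b $ l * d $ j)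
        = a $ i * c $ k * (b $ l * d $ j) + a $ k * c $ i * (b $ j * d $ l)"
      by (simp only: minus_one_add_cancel[OF m])
  qed
  \<comment> \<open>The two disjuncts involve disjoint sets of indices, so the quantifiers can be
    distributed.\<close>
  then have "(\<forall>i k. a $ i * c $ k = a $ k * c $ i) \<or> (\<forall>j l. b $ j * d $ l = b $ l * d $ j)"
    by blast
  then show ?thesis using par_if_cross_eq nz by blast
qed

lemma minus_one_mat_add:
  fixes m :: "'s::semifield" and A :: "'s ^ 'n ^ 'm"
  assumes "1 + m = 0"
  shows "A + mat_scale m A = 0"
  by (simp add: vec_eq_iff minus_one_add[OF assms])

text \<open>
  If \<open>A\<close> has a nonzero minor, then some \<open>Z\<close> of rank one has \<open>Z A Z = 0\<close> and \<open>A Z A \<noteq> 0\<close>, and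
  \<open>(I + A Z) A = A (I + Z A)\<close> is \<open>\<H>\<close>-related to \<open>A\<close> without being proportional to it.
\<close>

lemma green_H_scale_imp_rank1:
  fixes A :: "'s::semifield ^ 'n::finite ^ 'n"
  assumes m: "1 + m = (0 :: 's)" and "A \<noteq> 0" and H: "\<And>B. green_H A B \<Longrightarrow> \<exists>s. B = mat_scale s A"
  shows "rank1 A"
proof (rule ccontr)
  assume "\<not> rank1 A"
  then obtain i j k l where minor: "A $ i $ j * A $ k $ l \<noteq> A $ i $ l * A $ k $ j"
    using assms(2) by (auto simp: rank1_iff_minors)
  \<comment> \<open>Only row \<open>j\<close> of \<open>Z\<close> is nonzero. It is chosen to
    annihilate column \<open>j\<close> of \<open>A\<close>, while its product with column
    \<open>l\<close> is the nonzero minor up to sign.\<close>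
  define Z where "Z = mat_scale (A $ k $ j) (munit j i) + mat_scale (m * A $ i $ j) (munit j k)"
  define N where "N = A ** Z"
  have ZA: "(Z ** A) $ r $ q = (if r = j then A $ k $ j * A $ i $ q + m * (A $ i $ j * A $ k $ q) else 0)" for r q
    by (simp add: Z_def matrix_add_rdistrib mat_scale_mult_left munit_mult_nth mult.assoc)
  have NA: "(N ** A) $ r $ q = A $ r $ j * (A $ k $ j * A $ i $ q + m * (A $ i $ j * A $ k $ q))" for r q
  proof -
    have "N ** A = A ** (Z ** A)" by (simp add: N_def matrix_mul_assoc)
    then have "(N ** A) $ r $ q = (\<Sum>t\<in>UNIV. A $ r $ t * (Z ** A) $ t $ q)"
      by (simp add: matrix_matrix_mult_def)
    then show ?thesis by (simp add: ZA if_distrib cong: if_cong)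
  qed
  have NAj: "(N ** A) $ r $ j = 0" for r
    by (simp add: NA mult.commute[of "A $ k $ j"] minus_one_add[OF m])
  have "(N ** N) $ r $ q = 0" for r q
  proof -
    have "(N ** N) $ r $ q = (\<Sum>t\<in>UNIV. (N ** A) $ r $ t * Z $ t $ q)"
      by (simp add: N_def matrix_mul_assoc) (simp add: matrix_matrix_mult_def)
    also have "\<dots> = 0"
      using NAj by (auto simp: Z_def intro!: sum.neutral)
    finally show ?thesis .
  qed
  then have "N ** N = 0" by (simp add: vec_eq_iff)
  then have NNA: "N ** (N ** A) = 0" by (simp add: matrix_mul_assoc)
  define B where "B = A + N ** A"
  have "B = (mat 1 + N) ** A" by (simp add: B_def matrix_add_rdistrib)
  moreover have "B = A ** (mat 1 + Z ** A)"
    by (simp add: B_def N_def matrix_add_ldistrib matrix_mul_assoc)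
  \<comment> \<open>With \<open>m\<close> as -1 this reads
    \<open>(I - N) (I + N) A = A - N N A\<close>, and \<open>N ** (N ** A)\<close> vanishes.\<close>
  moreover have "(mat 1 + mat_scale m N) ** B = A + (N ** A + mat_scale m (N ** A)) + mat_scale m (N ** (N ** A))"
    by (simp add: B_def matrix_add_rdistrib matrix_add_ldistrib mat_scale_mult_left
        add_ac)
  then have "A = (mat 1 + mat_scale m N) ** B"
    by (simp only: NNA minus_one_mat_add[OF m]) (simp add: vec_eq_iff)
  moreover have "B ** (mat 1 + mat_scale m (Z ** A)) = A + (N ** A + mat_scale m (N ** A)) + mat_scale m (N ** (N ** A))"
    by (simp add: B_def N_def matrix_add_rdistrib matrix_add_ldistrib mat_scale_mult_right matrix_mul_assoc
        mat_scale_add add_ac)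
  then have "A = B ** (mat 1 + mat_scale m (Z ** A))"
    by (simp only: NNA minus_one_mat_add[OF m]) (simp add: vec_eq_iff)
  ultimately have "green_H A B"
    unfolding green_H_def leq_H_def leq_L_def leq_R_def by blast
  then obtain s where s: "B = mat_scale s A" using H by blast
  \<comment> \<open>Column \<open>j\<close> is the same in \<open>A\<close> and \<open>B\<close>,
    which forces \<open>s = 1\<close>; column \<open>l\<close> then makes the minor vanish.\<close>
  obtain r where r: "A $ r $ j \<noteq> 0" using minor by (metis mult_zero_left mult_zero_right)
  have "A $ r $ j + (N ** A) $ r $ j = s * A $ r $ j"
    using arg_cong[OF s, of "\<lambda>M. M $ r $ j"] by (simp add: B_def)
  then have "1 * A $ r $ j = s * A $ r $ j" by (simp add: NAj)
  then have "s = 1" using r by (metis mult_cancel_right)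
  then have "A $ r $ l + (N ** A) $ r $ l = A $ r $ l + 0"
    using arg_cong[OF s, of "\<lambda>M. M $ r $ l"] by (simp add: B_def)
  then have "(N ** A) $ r $ l = 0" by (simp only: minus_one_add_cancel[OF m])
  then have "A $ k $ j * A $ i $ l = A $ i $ j * A $ k $ l"
    using r by (simp add: NA minus_one_eq_iff[OF m])
  then show False using minor by (simp add: mult.commute)
qed

text \<open>Scaled swaps of rows \<open>i, k\<close> or of columns \<open>j, l\<close> pass between
  the two diagonals, and they exist over every semifield.\<close>

lemma green_H_antidiagonal:
  fixes s t :: "'s::semifield" and i :: "'n::finite"
  assumes "s \<noteq> 0" "t \<noteq> 0" "i \<noteq> k" "j \<noteq> l"
  shows "green_H (mat_scale s (munit i j) + mat_scale t (munit k l)) (munit i l + munit k j)"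
    (is "green_H ?A ?B")
proof -
  have "?A = (mat_scale s (munit i k) + mat_scale t (munit k i)) ** ?B"
    using assms by (auto simp: vec_eq_iff matrix_add_rdistrib mat_scale_mult_left munit_mult_nth)
  moreover have "?A = ?B ** (mat_scale s (munit l j) + mat_scale t (munit j l))"
    using assms by (auto simp: vec_eq_iff matrix_add_ldistrib mat_scale_mult_right mult_munit_nth)
  moreover have "?B = (mat_scale (sinv t) (munit i k) + mat_scale (sinv s) (munit k i)) ** ?A"
    using assms by (auto simp: vec_eq_iff matrix_add_rdistrib mat_scale_mult_left munit_mult_nth)
  moreover have "?B = ?A ** (mat_scale (sinv s) (munit j l) + mat_scale (sinv t) (munit l j))"
    using assms by (auto simp: vec_eq_iff matrix_add_ldistrib mat_scale_mult_right mult_munit_nth)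
  ultimately show ?thesis unfolding green_H_def leq_H_def leq_L_def leq_R_def by blast
qed

definition block :: "'n \<Rightarrow> 'n \<Rightarrow> 'n \<Rightarrow> 'n \<Rightarrow> 's \<Rightarrow> 's \<Rightarrow> 's \<Rightarrow> 's \<Rightarrow> 's::semifield ^ 'n ^ 'n"
  where "block i k j l a b c d = (\<chi> r q.
    if r = i then if q = j then a else if q = l then b else 0
    else if r = k then if q = j then c else if q = l then d else 0
    else 0)"

text \<open>The larger block arises both by swapping and scaling the rows and by swapping and
  scaling the columns. For nonzero entries it is \<open>a * b * c * d\<close> times the entrywise
  inverse of the original turned by 180 degrees.\<close>

lemma leq_H_block:
  fixes a b c d :: "'s::semifield" and i :: "'n::finite"
  assumes "i \<noteq> k" "j \<noteq> l"
  shows "leq_H (block i k j l (a * b * c) (a * b * d) (a * c * d) (b * c * d)) (block i k j l a b c d)"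
    (is "leq_H ?B ?A")
proof -
  have "?B = (mat_scale (a * b) (munit i k) + mat_scale (c * d) (munit k i)) ** ?A"
    using assms by (auto simp: vec_eq_iff matrix_add_rdistrib mat_scale_mult_left munit_mult_nth block_def ac_simps)
  moreover have "?B = ?A ** (mat_scale (a * c) (munit l j) + mat_scale (b * d) (munit j l))"
    using assms by (auto simp: vec_eq_iff matrix_add_ldistrib mat_scale_mult_right mult_munit_nth block_def ac_simps)
  ultimately show ?thesis unfolding leq_H_def leq_L_def leq_R_def by blast
qed

lemma leq_H_scaleD:
  assumes "leq_H (mat_scale s A) B" "s \<noteq> 0"
  shows "leq_H A B"
proof -
  obtain X Y where XY: "mat_scale s A = X ** B" "mat_scale s A = B ** Y"
    using assms(1) unfolding leq_H_def leq_L_def leq_R_def by blast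
  have "A = mat_scale (sinv s) (mat_scale s A)" using assms(2) by simp
  then have "A = mat_scale (sinv s) X ** B" "A = B ** mat_scale (sinv s) Y"
    using XY by (simp_all only: mat_scale_mult_left mat_scale_mult_right)
  then show ?thesis unfolding leq_H_def leq_L_def leq_R_def by blast
qed

text \<open>Applying the construction of \<open>leq_H_block\<close> twice returns the original block
  times the square of \<open>a * b * c * d\<close>, so the converse comparison is another instance
  of the first.\<close>

lemma green_H_block:
  fixes a b c d :: "'s::semifield" and i :: "'n::finite"
  assumes "i \<noteq> k" "j \<noteq> l" "a \<noteq> 0" "b \<noteq> 0" "c \<noteq> 0" "d \<noteq> 0"
  shows "green_H (block i k j l a b c d)
    (block i k j l (a * b * c) (a * b * d) (a * c * d) (b * c * d))" (is "green_H ?A ?B")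
proof -
  let ?s = "a * b * c * d * (a * b * c * d)"
  have "leq_H (mat_scale ?s ?A) ?B"
  proof -
    have "mat_scale ?s ?A = block i k j l (a * b * c * (a * b * d) * (a * c * d))
      (a * b * c * (a * b * d) * (b * c * d)) (a * b * c * (a * c * d) * (b * c * d))
      (a * b * d * (a * c * d) * (b * c * d))"
      by (auto simp: vec_eq_iff block_def ac_simps)
    then show ?thesis by (simp only: leq_H_block[OF assms(1,2)])
  qed
  then show ?thesis
    using leq_H_scaleD leq_H_block[OF assms(1,2)] assms(3-6) unfolding green_H_def by force
qed

section \<open>Maps preserving collinearity of matrix units\<close>

lemma outer_eq_scale_munit_imp_par:
  fixes x :: "'s::semifield ^ 'm" and y :: "'s ^ 'n"
  assumes "outer x y = mat_scale s (munit k l)" "s \<noteq> 0"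
  shows "par x (axis k 1)" "par y (axis l 1)"
proof -
  have e: "x $ r * y $ q = (if r = k \<and> q = l then s else 0)" for r q
    using arg_cong[OF assms(1), of "\<lambda>M. M $ r $ q"] by auto
  have nz: "x $ k \<noteq> 0" "y $ l \<noteq> 0" using e[of k l] assms(2) by auto
  have "x $ r = 0" if "r \<noteq> k" for r using e[of r l] that nz by simp
  then have "x = x $ k *s axis k 1" by (auto simp: vec_eq_iff axis_nth)
  then show "par x (axis k 1)" unfolding par_def using nz by blast
  have "y $ q = 0" if "q \<noteq> l" for q using e[of k q] that nz by simp
  then have "y = y $ l *s axis l 1" by (auto simp: vec_eq_iff axis_nth)
  then show "par y (axis l 1)" unfolding par_def using nz by blast
qed

lemma par_trans_sym: "par u w \<Longrightarrow> par v w \<Longrightarrow> par u v"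
  using equivp_par equivp_symp equivp_transp by metis

lemma axis_add_axis_nonzero:
  "a \<noteq> b \<Longrightarrow> axis a 1 + axis b 1 \<noteq> (0 :: 's::semifield ^ 'n)"
  by (metis (no_types) add.right_neutral axis_nth vector_add_component zero_index zero_neq_one)

lemma rank1_munit_add_munit_row:
  "j \<noteq> j' \<Longrightarrow> rank1 (munit i j + munit i j' :: 's::semifield ^ 'n ^ 'm)"
  using rank1_outer[OF axis_1_nonzero axis_add_axis_nonzero] by (simp add: munit_def outer_add_right)

lemma rank1_munit_add_munit_column:
  "i \<noteq> i' \<Longrightarrow> rank1 (munit i j + munit i' j :: 's::semifield ^ 'n ^ 'm)"
  using rank1_outer[OF axis_add_axis_nonzero axis_1_nonzero] by (simp add: munit_def outer_add_left)

text \<open>Lying in a common row or column enters as rank one of the sum of two matrix units, the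
  form in which the preservation hypotheses deliver it.\<close>

lemma mult_hadamard_form_if_lines:
  fixes T :: "'s::semifield ^ 'n::finite ^ 'n \<Rightarrow> 's ^ 'n ^ 'n"
  assumes "bij T" "mat_linear T" and T: "\<And>i j. rank1 (T (munit i j))"
    and lines: "\<And>i j i' j' x y x' y'. rank1 (munit i j + munit i' j' :: 's ^ 'n ^ 'n) \<Longrightarrow>
      T (munit i j) = outer x y \<Longrightarrow> T (munit i' j') = outer x' y' \<Longrightarrow> par x x' \<or> par y y'"
  obtains P C Q where "mult_hadamard_form T P C Q"
proof -
  have "\<forall>i j. \<exists>x y. T (munit i j) = outer x y" using T by (auto simp: rank1_def)
  then obtain x y where xy: "\<And>i j. T (munit i j) = outer (x i j) (y i j)" by metis
  have refl: "par u u" for u :: "'s ^ 'n" using equivp_reflp[OF equivp_par] .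
  have "par (x i j) (x i k) \<or> par (y i j) (y i k)" for i j k
    using lines[OF rank1_munit_add_munit_row xy xy, of j k i] refl by (cases "j = k") auto
  moreover have "par (x i j) (x k j) \<or> par (y i j) (y k j)" for i j k
    using lines[OF rank1_munit_add_munit_column xy xy, of i k j] refl by (cases "i = k") auto
  ultimately show ?thesis
    using bij_linear_mult_hadamard_form[OF assms(1,2) xy] that by blast
qed

lemma lines_if_minus_one:
  fixes T :: "'s::semifield ^ 'n::finite ^ 'n \<Rightarrow> 's ^ 'n ^ 'n"
  assumes m: "1 + m = (0 :: 's)" and "mat_linear T" and T: "\<And>A. rank1 A \<Longrightarrow> rank1 (T A)"
    and r: "rank1 (munit i j + munit i' j' :: 's ^ 'n ^ 'n)"
    and xy: "T (munit i j) = outer x y" "T (munit i' j') = outer x' y'"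
  shows "par x x' \<or> par y y'"
proof -
  have "rank1 (outer x y)" "rank1 (outer x' y')" using T[OF rank1_munit] xy by metis+
  then have "x \<noteq> 0" "y \<noteq> 0" "x' \<noteq> 0" "y' \<noteq> 0" by (auto simp: rank1_def)
  moreover have "rank1 (outer x y + outer x' y')"
    using T[OF r] by (simp add: mat_linear_add[OF assms(2)] xy)
  ultimately show ?thesis by (intro rank1_outer_add_outer_imp_par[OF m])
qed

lemma lines_if_scaled_munits:
  assumes "s \<noteq> 0" "t \<noteq> 0" "outer x y = mat_scale s (munit k l)"
    "outer x' y' = mat_scale t (munit k' l')" "k = k' \<or> l = l'"
  shows "par x x' \<or> par y y'"
  using outer_eq_scale_munit_imp_par[OF assms(3,1)] outer_eq_scale_munit_imp_par[OF assms(4,2)]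
    assms(5) par_trans_sym by metis

section \<open>Preservers of H\<close>

definition standard_form :: "('s::semifield ^ 'n::finite ^ 'n \<Rightarrow> 's ^ 'n ^ 'n) \<Rightarrow> bool"
  where "standard_form T \<longleftrightarrow> (\<exists>P Q. invertible P \<and> invertible Q \<and>
    ((\<forall>A. T A = P ** A ** Q) \<or> (\<forall>A. T A = P ** transpose A ** Q)))"

lemma standard_form_cases:
  assumes "standard_form T"
  obtains P P' Q Q' where "P ** P' = mat 1" "P' ** P = mat 1" "Q ** Q' = mat 1" "Q' ** Q = mat 1"
    "(\<forall>A. T A = P ** A ** Q) \<or> (\<forall>A. T A = P ** transpose A ** Q)"
  using assms unfolding standard_form_def invertible_def by blast

section \<open>Standard forms: preservation of the preorders, and inverses\<close>

lemma leq_H_mult: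
  assumes "leq_H A B" "P' ** P = mat 1" "Q ** Q' = mat 1"
  shows "leq_H (P ** A ** Q) (P ** B ** Q)"
proof -
  obtain X Y where XY: "A = X ** B" "A = B ** Y"
    using assms(1) unfolding leq_H_def leq_L_def leq_R_def by blast
  have "(P ** X ** P') ** (P ** B ** Q) = P ** X ** (P' ** P) ** B ** Q"
    by (simp only: matrix_mul_assoc)
  then have "P ** A ** Q = (P ** X ** P') ** (P ** B ** Q)"
    by (simp add: assms(2) XY(1) matrix_mul_assoc)
  moreover have "(P ** B ** Q) ** (Q' ** Y ** Q) = P ** B ** (Q ** Q') ** Y ** Q"
    by (simp only: matrix_mul_assoc)
  then have "P ** A ** Q = (P ** B ** Q) ** (Q' ** Y ** Q)"
    by (simp add: assms(3) XY(2) matrix_mul_assoc)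
  ultimately show ?thesis unfolding leq_H_def leq_L_def leq_R_def by blast
qed

lemma leq_H_transpose: "leq_H A B \<Longrightarrow> leq_H (transpose A) (transpose B)"
  unfolding leq_H_def leq_L_def leq_R_def by (metis matrix_transpose_mul)

lemma leq_J_mult:
  assumes "leq_J A B" "P' ** P = mat 1" "Q ** Q' = mat 1"
  shows "leq_J (P ** A ** Q) (P ** B ** Q)"
proof -
  obtain X Y where XY: "A = X ** B ** Y" using assms(1) unfolding leq_J_def by blast
  have "(P ** X ** P') ** (P ** B ** Q) ** (Q' ** Y ** Q)
      = P ** X ** (P' ** P) ** B ** (Q ** Q') ** Y ** Q"
    by (simp only: matrix_mul_assoc)
  then have "P ** A ** Q = (P ** X ** P') ** (P ** B ** Q) ** (Q' ** Y ** Q)"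
    by (simp add: assms(2,3) XY matrix_mul_assoc)
  then show ?thesis unfolding leq_J_def by blast
qed

lemma leq_J_transpose: "leq_J A B \<Longrightarrow> leq_J (transpose A) (transpose B)"
  unfolding leq_J_def by (metis matrix_transpose_mul matrix_mul_assoc)

lemma standard_form_preserves_leq_H:
  assumes "standard_form T" shows "preserves T leq_H"
  using standard_form_cases[OF assms] leq_H_mult leq_H_transpose
  unfolding preserves_def by metis

lemma standard_form_preserves_leq_J:
  assumes "standard_form T" shows "preserves T leq_J"
  using standard_form_cases[OF assms] leq_J_mult leq_J_transpose
  unfolding preserves_def by metis

text \<open>The argument for H classifies \<open>inv T\<close>, and this carries the result back. In
  the transposed case the inverse factors are transposed and change sides.\<close>

lemma standard_form_inv:
  assumes "standard_form (inv T)" "bij T"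
  shows "standard_form T"
proof -
  obtain P P' Q Q' where PQ: "P ** P' = mat 1" "P' ** P = mat 1" "Q ** Q' = mat 1" "Q' ** Q = mat 1"
    and U: "(\<forall>A. inv T A = P ** A ** Q) \<or> (\<forall>A. inv T A = P ** transpose A ** Q)"
    using assms(1) by (rule standard_form_cases)
  have U': "inv T (T A) = A" for A using assms(2) by (simp add: bij_is_inj)
  have cancel: "P' ** (P ** B ** Q) ** Q' = B" for B
  proof -
    have "P' ** (P ** B ** Q) ** Q' = (P' ** P) ** B ** (Q ** Q')" by (simp only: matrix_mul_assoc)
    then show ?thesis by (simp add: PQ)
  qed
  have inv: "invertible P'" "invertible Q'" "invertible (transpose P')" "invertible (transpose Q')"
    using PQ unfolding invertible_def by (metis matrix_transpose_mul transpose_mat)+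
  from U show ?thesis
  proof
    assume "\<forall>A. inv T A = P ** A ** Q"
    then have "T A = P' ** A ** Q'" for A using U'[of A] cancel[of "T A"] by metis
    then show ?thesis unfolding standard_form_def using inv by blast
  next
    assume "\<forall>A. inv T A = P ** transpose A ** Q"
    then have "transpose (T A) = P' ** A ** Q'" for A using U'[of A] cancel[of "transpose (T A)"] by metis
    then have "T A = transpose (P' ** A ** Q')" for A by (metis transpose_transpose)
    then have "T A = transpose Q' ** transpose A ** transpose P'" for A
      by (simp add: matrix_transpose_mul matrix_mul_assoc)
    then show ?thesis unfolding standard_form_def using inv by blast
  qed
qed

text \<open>Since \<open>T\<close> maps \<open>inv T A\<close> to rank one, the H-class of
  \<open>inv T A\<close> consists of its multiples; over a field
  \<open>green_H_scale_imp_rank1\<close> then applies.\<close>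

lemma preserves_green_H_inv_rank1:
  fixes T :: "'s::semifield ^ 'n::finite ^ 'n \<Rightarrow> 's ^ 'n ^ 'n"
  assumes "1 + m = (0 :: 's)" "bij T" "mat_linear T" "preserves T green_H" "rank1 A"
  shows "rank1 (inv T A)"
proof -
  have TU: "T (inv T A) = A" using assms(2) by (simp add: bij_is_surj surj_f_inv_f)
  then have "inv T A \<noteq> 0" using assms(5) mat_linear_0[OF assms(3)] by (auto simp: rank1_def)
  then show ?thesis
    using green_H_scale_imp_rank1[OF assms(1)] preserves_green_H_rank1[OF assms(2-4)] assms(5) TU
    by metis
qed

lemma preserves_green_H_inv_mult_hadamard_form:
  fixes T :: "'s::semifield ^ 'n::finite ^ 'n \<Rightarrow> 's ^ 'n ^ 'n"
  assumes T: "bij T" "mat_linear T" "preserves T green_H"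
  obtains P C Q where "mult_hadamard_form (inv T) P C Q"
proof -
  have U: "bij (inv T)" "mat_linear (inv T)"
    using T by (simp_all add: bij_imp_bij_inv mat_linear_inv)
  show ?thesis
  proof (cases "zerosumfree TYPE('s)")
    case True
    then obtain s k l where s: "\<And>i j. s i j \<noteq> 0"
      "\<And>i j. inv T (munit i j) = mat_scale (s i j) (munit (k i j) (l i j))"
      using zerosumfree_mat_linear_munit[OF True U] by metis
    show ?thesis
    proof (rule mult_hadamard_form_if_lines[OF U])
      show "rank1 (inv T (munit i j))" for i j by (simp add: s rank1_mat_scale)
      fix i j i' j' x y x' y'
      assume r: "rank1 (munit i j + munit i' j' :: 's ^ 'n ^ 'n)"
        and xy: "inv T (munit i j) = outer x y" "inv T (munit i' j') = outer x' y'"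
      let ?A = "inv T (munit i j + munit i' j')"
      let ?B = "munit (k i j) (l i' j') + munit (k i' j') (l i j)"
      have A: "?A = mat_scale (s i j) (munit (k i j) (l i j)) + mat_scale (s i' j') (munit (k i' j') (l i' j'))"
        by (simp add: mat_linear_add[OF U(2)] s)
      have "k i j = k i' j' \<or> l i j = l i' j'"
      proof (rule ccontr)
        assume ne: "\<not> ?thesis"
        then have "green_H ?A ?B" unfolding A by (intro green_H_antidiagonal s) auto
        moreover have "rank1 (T ?A)" using r T(1) by (simp add: bij_is_surj surj_f_inv_f)
        ultimately obtain c where "?B = mat_scale c ?A"
          using preserves_green_H_rank1[OF T] by blast
        \<comment> \<open>At this corner \<open>?B\<close> has entry 1, whereas \<open>?A\<close>
          lives on the other diagonal.\<close>
        from arg_cong[OF this, of "\<lambda>M. M $ k i j $ l i' j'"] ne show False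
          unfolding A by auto
      qed
      then show "par x x' \<or> par y y'"
        using lines_if_scaled_munits[OF s(1) s(1)] xy s(2) by metis
    qed (rule that)
  next
    case False
    then obtain m :: 's where m: "1 + m = 0" by (rule not_zerosumfree_imp_minus_one)
    note r = preserves_green_H_inv_rank1[OF m T]
    show ?thesis
      by (rule mult_hadamard_form_if_lines[OF U r[OF rank1_munit] lines_if_minus_one[OF m U(2) r] that])
  qed
qed

lemma rank1_transpose: "rank1 A \<Longrightarrow> rank1 (transpose A)"
  unfolding rank1_iff_minors by (simp add: transpose_def vec_eq_iff mult.commute) blast

lemma preserves_green_H_imp_standard_form:
  fixes T :: "'s::semifield ^ 'n::finite ^ 'n \<Rightarrow> 's ^ 'n ^ 'n"
  assumes T: "bij T" "mat_linear T" "preserves T green_H"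
  shows "standard_form T"
proof -
  obtain P C Q where form: "mult_hadamard_form (inv T) P C Q"
    using preserves_green_H_inv_mult_hadamard_form[OF T] .
  then obtain P' Q' F where PQ: "P ** P' = mat 1" "P' ** P = mat 1" "Q ** Q' = mat 1" "Q' ** Q = mat 1"
    and C: "\<And>i j. C $ i $ j \<noteq> 0" and F: "F = id \<or> F = transpose"
    and U: "\<And>A. inv T A = P ** hadamard C (F A) ** Q"
    unfolding mult_hadamard_form_def invertible_def by blast
  have FF: "F (F A) = A" for A using F by auto
  have minor: "C $ i $ j * C $ k $ l = C $ i $ l * C $ k $ j" if ne: "i \<noteq> k" "j \<noteq> l" for i j k l
  proof -
    let ?a = "C $ i $ j" and ?b = "C $ i $ l" and ?c = "C $ k $ j" and ?d = "C $ k $ l"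
    let ?A = "block i k j l ?a ?b ?c ?d"
    let ?B = "block i k j l (?a * ?b * ?c) (?a * ?b * ?d) (?a * ?c * ?d) (?b * ?c * ?d)"
    \<comment> \<open>\<open>?E\<close> is all ones on the chosen rows and columns, so its entrywise
      product with \<open>C\<close> cuts out the block of \<open>C\<close>.\<close>
    let ?E = "outer (axis i 1 + axis k 1) (axis j 1 + axis l 1) :: 's ^ 'n ^ 'n"
    have "hadamard C ?E = ?A"
      using ne by (auto simp: vec_eq_iff block_def axis_nth)
    then have "inv T (F ?E) = P ** ?A ** Q" by (simp add: U FF)
    then have "T (P ** ?A ** Q) = F ?E" using T(1) by (metis bij_is_surj surj_f_inv_f)
    moreover have "rank1 ?E" using ne by (intro rank1_outer axis_add_axis_nonzero)
    then have "rank1 (F ?E)" using F rank1_transpose by auto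
    moreover have "green_H (P ** ?A ** Q) (P ** ?B ** Q)"
      using green_H_block[OF ne C C C C] leq_H_mult PQ unfolding green_H_def by blast
    ultimately obtain s where "P ** ?B ** Q = mat_scale s (P ** ?A ** Q)"
      using preserves_green_H_rank1[OF T] by metis
    then have "P' ** (P ** ?B ** Q) ** Q' = mat_scale s (P' ** (P ** ?A ** Q) ** Q')"
      by (simp add: mat_scale_mult_left mat_scale_mult_right)
    moreover have "P' ** (P ** M ** Q) ** Q' = (P' ** P) ** M ** (Q ** Q')" for M
      by (simp only: matrix_mul_assoc)
    ultimately have B: "?B = mat_scale s ?A" by (simp add: PQ)
    \<comment> \<open>The two entries of row \<open>i\<close> give \<open>b c = s\<close> and
      \<open>a d = s\<close>, which is the vanishing of the minor.\<close>
    have "?a * ?b * ?c = s * ?a" "?a * ?b * ?d = s * ?b"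
      using arg_cong[OF B, of "\<lambda>M. M $ i $ j"] arg_cong[OF B, of "\<lambda>M. M $ i $ l"] ne
      by (auto simp: block_def)
    then have "?a * (?b * ?c) = ?a * s" "?b * (?a * ?d) = ?b * s" by (simp_all add: ac_simps)
    then have "?b * ?c = s" "?a * ?d = s" using C by (metis mult_cancel_left)+
    then show ?thesis by simp
  qed
  have "C $ i $ j * C $ k $ l = C $ i $ l * C $ k $ j" for i j k l
    using minor[of i k j l] by (cases "i = k \<or> j = l") (auto simp: mult.commute)
  moreover have "C \<noteq> 0" using C by (auto simp: vec_eq_iff)
  ultimately have "rank1 C" unfolding rank1_iff_minors by blast
  then have "standard_form (inv T)"
    using mult_hadamard_form_rank1[OF bij_imp_bij_inv[OF T(1)] form] unfolding standard_form_def by blast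
  then show ?thesis using T(1) by (rule standard_form_inv)
qed

section \<open>Preservers of J\<close>

lemma leq_J_rank1:
  assumes "leq_J A B" "rank1 B" "A \<noteq> 0"
  shows "rank1 A"
  using assms unfolding leq_J_def rank1_def by (metis mult_outer outer_mult)

lemma green_J_rank1:
  assumes "green_J A B" "rank1 A"
  shows "rank1 B"
proof (rule leq_J_rank1)
  show "leq_J B A" using assms(1) by (simp add: green_J_def)
  show "rank1 A" by fact
  obtain X Y where "A = X ** B ** Y" using assms(1) by (auto simp: green_J_def leq_J_def)
  then show "B \<noteq> 0" using assms(2) by (auto simp: rank1_def)
qed

text \<open>Dividing by a nonzero coordinate of \<open>x\<close> gives a matrix that sends
  \<open>x\<close> to \<open>u\<close>, and similarly for \<open>y\<close> and \<open>v\<close>.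
  Hence rank one matrices form a single J-class.\<close>

lemma rank1_imp_leq_J:
  fixes A B :: "'s::semifield ^ 'n::finite ^ 'n"
  assumes "rank1 A" "rank1 B"
  shows "leq_J A B"
proof -
  obtain u v where A: "A = outer u v" using assms(1) by (rule rank1E)
  obtain x y where B: "B = outer x y" "x \<noteq> 0" "y \<noteq> 0" using assms(2) by (rule rank1E)
  obtain i j where ij: "x $ i \<noteq> 0" "y $ j \<noteq> 0" using B by (auto simp: vec_eq_iff)
  have "outer u (axis i (sinv (x $ i))) *v x = u"
    using ij by (simp add: vec_eq_iff matrix_vector_mult_def axis_nth if_distrib if_distribR mult.assoc cong: if_cong)
  moreover have "y v* outer (axis j (sinv (y $ j))) v = v"
    using ij by (simp add: vec_eq_iff vector_matrix_mult_def axis_nth if_distrib if_distribR mult.assoc[symmetric] cong: if_cong)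
  ultimately have "A = outer u (axis i (sinv (x $ i))) ** B ** outer (axis j (sinv (y $ j))) v"
    unfolding A B mult_outer[of _ x y] by (simp add: outer_mult)
  then show ?thesis unfolding leq_J_def by blast
qed

lemma green_J_mult_right:
  assumes "Y ** Y' = mat 1"
  shows "green_J A (A ** Y)"
proof -
  have "A = mat 1 ** (A ** Y) ** Y'" by (simp add: assms flip: matrix_mul_assoc)
  moreover have "A ** Y = mat 1 ** A ** Y" by simp
  ultimately show ?thesis unfolding green_J_def leq_J_def by metis
qed

lemma green_J_mat_scale:
  assumes "s \<noteq> 0"
  shows "green_J A (mat_scale s A)"
  using green_J_mult_right[of "mat_scale s (mat 1)" "mat_scale (sinv s) (mat 1)" A] assms
  by (simp add: mat_scale_mult_left mat_scale_mult_right)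

lemma green_J_trans: "green_J A B \<Longrightarrow> green_J B C \<Longrightarrow> green_J A C"
proof -
  have "leq_J A C" if AB: "leq_J A B" and BC: "leq_J B C" for A B C :: "'s::semifield ^ 'n::finite ^ 'n"
  proof -
    obtain X Y X' Y' where "A = X ** B ** Y" "B = X' ** C ** Y'"
      using AB BC unfolding leq_J_def by blast
    then have "A = (X ** X') ** C ** (Y' ** Y)" by (simp add: matrix_mul_assoc)
    then show ?thesis unfolding leq_J_def by blast
  qed
  then show "green_J A B \<Longrightarrow> green_J B C \<Longrightarrow> green_J A C" unfolding green_J_def by blast
qed

text \<open>Since \<open>w $ j = 0\<close>, the outer product squares to zero, so
  \<open>I + Z\<close> has the inverse \<open>I - Z\<close>.\<close>

lemma green_J_transvection:
  fixes A :: "'s::semifield ^ 'n::finite ^ 'n"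
  assumes m: "1 + m = (0 :: 's)" and "w $ j = 0"
  shows "green_J A (A + A ** outer (axis j 1) w)"
proof -
  let ?Z = "outer (axis j 1) w"
  have ZZ: "?Z ** ?Z = 0"
    using assms(2) by (auto simp: vec_eq_iff matrix_matrix_mult_def axis_nth intro!: sum.neutral)
  have "(mat 1 + ?Z) ** (mat 1 + mat_scale m ?Z) = mat 1 + (?Z + mat_scale m ?Z) + mat_scale m (?Z ** ?Z)"
    by (simp add: matrix_add_rdistrib matrix_add_ldistrib mat_scale_mult_right mat_scale_add add_ac)
  then have "(mat 1 + ?Z) ** (mat 1 + mat_scale m ?Z) = mat 1"
    by (simp only: ZZ minus_one_mat_add[OF m]) (simp add: vec_eq_iff)
  from green_J_mult_right[OF this, of A] show ?thesis by (simp add: matrix_add_ldistrib)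
qed

text \<open>
  On the pencil \<open>X + t Y\<close> of two matrices of rank one every minor is linear in \<open>t\<close>.
\<close>

lemma rank1_pencil:
  fixes X Y :: "'s::semifield ^ 'n ^ 'n"
  assumes m: "1 + m = (0 :: 's)" and r: "rank1 X" "rank1 Y" "rank1 (X + mat_scale t Y)" "t \<noteq> 0"
    and "X + Y \<noteq> 0"
  shows "rank1 (X + Y)"
  unfolding rank1_iff_minors
proof (intro conjI allI)
  show "X + Y \<noteq> 0" by fact
  fix i j k l
  note X = rank1_minors[OF r(1), of i j k l] and Y = rank1_minors[OF r(2), of i j k l]
  \<comment> \<open>The constant and quadratic terms in \<open>t\<close> agree on both sides because
    the minors of \<open>X\<close> and \<open>Y\<close> vanish. Only the mixed term remains, and
    \<open>t\<close> can be cancelled from it.\<close>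
  let ?p = "X $ i $ l * X $ k $ j + t * t * (Y $ i $ l * Y $ k $ j)"
  have "?p + t * (X $ i $ j * Y $ k $ l + Y $ i $ j * X $ k $ l)
      = (X $ i $ j * X $ k $ l + t * t * (Y $ i $ j * Y $ k $ l))
        + t * (X $ i $ j * Y $ k $ l + Y $ i $ j * X $ k $ l)"
    by (simp add: X Y)
  also have "\<dots> = (X + mat_scale t Y) $ i $ j * (X + mat_scale t Y) $ k $ l"
    by (simp add: distrib_left distrib_right ac_simps)
  also have "\<dots> = (X + mat_scale t Y) $ i $ l * (X + mat_scale t Y) $ k $ j"
    by (rule rank1_minors[OF r(3)])
  also have "\<dots> = ?p + t * (X $ i $ l * Y $ k $ j + Y $ i $ l * X $ k $ j)"
    by (simp add: distrib_left distrib_right ac_simps)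
  finally have "X $ i $ j * Y $ k $ l + Y $ i $ j * X $ k $ l = X $ i $ l * Y $ k $ j + Y $ i $ l * X $ k $ j"
    using r(4) by (simp only: minus_one_add_cancel[OF m] mult_cancel_left) simp
  then have "(X $ i $ j * X $ k $ l + Y $ i $ j * Y $ k $ l) + (X $ i $ j * Y $ k $ l + Y $ i $ j * X $ k $ l)
    = (X $ i $ l * X $ k $ j + Y $ i $ l * Y $ k $ j) + (X $ i $ l * Y $ k $ j + Y $ i $ l * X $ k $ j)"
    by (simp add: X Y)
  then show "(X + Y) $ i $ j * (X + Y) $ k $ l = (X + Y) $ i $ l * (X + Y) $ k $ j"
    by (simp add: distrib_left distrib_right ac_simps)
qed

section \<open>Characteristic two and the two-element field\<close>

lemma char2_vec_eq_iff:
  fixes x y :: "'s::semifield ^ 'n"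
  assumes "1 + 1 = (0 :: 's)"
  shows "x + y = 0 \<longleftrightarrow> x = y"
  using minus_one_eq_iff[OF assms] by (simp add: vec_eq_iff)

lemma char2_mat_eq_iff:
  fixes X Y :: "'s::semifield ^ 'n ^ 'm"
  assumes "1 + 1 = (0 :: 's)"
  shows "X + Y = 0 \<longleftrightarrow> X = Y"
  using minus_one_eq_iff[OF assms] by (simp add: vec_eq_iff)

text \<open>In a row \<open>r\<close> where \<open>u\<close> and \<open>u'\<close> differ, exactly
  one of \<open>v\<close>, \<open>v'\<close> occurs. The hypotheses exclude that it vanishes alone
  or cancels against one of \<open>q\<close>, \<open>q'\<close>, so it cancels against both.\<close>

lemma four_outers_sum_0:
  fixes u v :: "'s::semifield ^ 'n"
  assumes two: "\<And>x :: 's. x = 0 \<or> x = 1" "1 + 1 = (0 :: 's)"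
    and sum: "outer u v + outer u' v' + outer p q + outer p' q' = (0 :: 's ^ 'n ^ 'n)"
    and "u \<noteq> u'" and nz: "v \<noteq> 0" "v' \<noteq> 0" "v \<noteq> q" "v \<noteq> q'" "v' \<noteq> q" "v' \<noteq> q'"
  shows "v + q + q' = 0 \<or> v' + q + q' = 0"
proof -
  obtain r where r: "u $ r \<noteq> u' $ r" using assms(4) by (auto simp: vec_eq_iff)
  have "u $ r *s v + u' $ r *s v' + p $ r *s q + p' $ r *s q' = 0"
    using arg_cong[OF sum, of "\<lambda>M. M $ r"] by (simp add: vec_eq_iff)
  moreover have "v + q = 0 \<longleftrightarrow> v = q" "v + q' = 0 \<longleftrightarrow> v = q'" "v' + q = 0 \<longleftrightarrow> v' = q" "v' + q' = 0 \<longleftrightarrow> v' = q'"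
    by (simp_all only: char2_vec_eq_iff[OF two(2)])
  ultimately show ?thesis
    using two(1)[of "u $ r"] two(1)[of "u' $ r"] two(1)[of "p $ r"] two(1)[of "p' $ r"] r nz by auto
qed

text \<open>A common factor of two of the matrices would make their sum an outer product, nonzero by
  distinctness, so the factors are pairwise distinct on each side. Splitting the sum in two ways
  gives two relations among three right factors each, and these identify two of the four.\<close>

lemma four_rank1_sum_0:
  fixes X0 X1 X2 X3 :: "'s::semifield ^ 'n ^ 'n"
  assumes two: "\<And>x :: 's. x = 0 \<or> x = 1" "1 + 1 = (0 :: 's)"
    and X: "rank1 X0" "rank1 X1" "rank1 X2" "rank1 X3"
    and sum: "X0 + X1 + X2 + X3 = (0 :: 's ^ 'n ^ 'n)"
    and pairs: "\<And>Y Z. Y \<in> {X0, X1, X2, X3} \<Longrightarrow> Z \<in> {X0, X1, X2, X3} \<Longrightarrow> rank1 (Y + Z) \<Longrightarrow> False"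
    and dist: "distinct [X0, X1, X2, X3]"
  shows False
proof -
  obtain u0 v0 u1 v1 u2 v2 u3 v3 where
    o: "X0 = outer u0 v0" "X1 = outer u1 v1" "X2 = outer u2 v2" "X3 = outer u3 v3"
    and nz: "v0 \<noteq> 0" "v1 \<noteq> 0" "v2 \<noteq> 0" "v3 \<noteq> 0"
    using X by (metis rank1E)
  have ne: "u \<noteq> u' \<and> v \<noteq> v'" if "outer u v \<in> {X0, X1, X2, X3}" "outer u' v' \<in> {X0, X1, X2, X3}"
    "outer u v \<noteq> outer u' v'" for u v u' v'
  proof -
    have "rank1 (outer u v + outer u' v')" if "u = u' \<or> v = v'"
    proof -
      have "outer u v + outer u' v' \<noteq> 0"
        using \<open>outer u v \<noteq> outer u' v'\<close> unfolding char2_mat_eq_iff[OF two(2)] .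
      moreover have "\<exists>x y. outer u v + outer u' v' = outer x y"
        using that outer_add_left[of u u' v] outer_add_right[of u v v'] by metis
      ultimately show ?thesis unfolding rank1_def by blast
    qed
    then show ?thesis using pairs[OF that(1,2)] by blast
  qed
  have u: "u0 \<noteq> u1" "u2 \<noteq> u3" using ne[of u0 v0 u1 v1] ne[of u2 v2 u3 v3] dist by (auto simp: o)
  have v: "v0 \<noteq> v1" "v0 \<noteq> v2" "v0 \<noteq> v3" "v1 \<noteq> v2" "v1 \<noteq> v3" "v2 \<noteq> v3"
    using ne[of u0 v0 u1 v1] ne[of u0 v0 u2 v2] ne[of u0 v0 u3 v3] ne[of u1 v1 u2 v2]
      ne[of u1 v1 u3 v3] ne[of u2 v2 u3 v3] dist by (auto simp: o)
  have cancel: "x = y" if "x + z + w = 0" "y + z + w = 0" for x y z w :: "'s ^ 'n"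
  proof -
    have "(z + w) + x = (z + w) + y" using that by (simp add: add_ac)
    then show ?thesis by (simp add: vec_eq_iff minus_one_add_cancel[OF two(2)])
  qed
  have "v0 + v2 + v3 = 0 \<or> v1 + v2 + v3 = 0"
    by (rule four_outers_sum_0[OF two, of u0 v0 u1 v1 u2 v2 u3 v3]) (use sum u v nz in \<open>auto simp: o\<close>)
  moreover have "v2 + v0 + v1 = 0 \<or> v3 + v0 + v1 = 0"
    by (rule four_outers_sum_0[OF two, of u2 v2 u3 v3 u0 v0 u1 v1])
      (use sum u v nz in \<open>auto simp: o add_ac\<close>)
  moreover have "v3 = v1" if "v0 + v2 + v3 = 0" "v2 + v0 + v1 = 0"
    by (rule cancel[where z = v0 and w = v2]) (use that in \<open>simp_all add: add_ac\<close>)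
  moreover have "v2 = v1" if "v0 + v2 + v3 = 0" "v3 + v0 + v1 = 0"
    by (rule cancel[where z = v0 and w = v3]) (use that in \<open>simp_all add: add_ac\<close>)
  moreover have "v3 = v0" if "v1 + v2 + v3 = 0" "v2 + v0 + v1 = 0"
    by (rule cancel[where z = v1 and w = v2]) (use that in \<open>simp_all add: add_ac\<close>)
  moreover have "v2 = v0" if "v1 + v2 + v3 = 0" "v3 + v0 + v1 = 0"
    by (rule cancel[where z = v1 and w = v3]) (use that in \<open>simp_all add: add_ac\<close>)
  ultimately show False using v by blast
qed

text \<open>
  Over the two-element field with \<open>n = 2\<close>, the quadratic form \<open>det (T M)\<close> would vanish exactly at
  the invertible \<open>M\<close> and at \<open>0\<close>; polarisation rules this out.
\<close>

lemma char2_two_dim_contradiction: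
  fixes T :: "'s::semifield ^ 'n::finite ^ 'n \<Rightarrow> 's ^ 'n ^ 'n"
  assumes two: "\<And>x :: 's. x = 0 \<or> x = 1" "1 + 1 = (0 :: 's)"
    and jl: "UNIV = {j, l :: 'n}" "j \<noteq> l"
    and T: "bij T" "mat_linear T" "preserves T green_J"
    and none: "\<And>E. rank1 E \<Longrightarrow> \<not> rank1 (T E)"
    and A: "A \<noteq> 0" "rank1 (T A)"
  shows False
proof -
  have idx: "i = j \<or> i = l" for i using jl(1) by blast
  have dbl: "x + x = 0" for x :: 's using minus_one_add[OF two(2), of x] by simp
  \<comment> \<open>The determinant, with plus for minus in characteristic two.\<close>
  define q :: "'s ^ 'n ^ 'n \<Rightarrow> 's" where "q M = M $ j $ j * M $ l $ l + M $ j $ l * M $ l $ j" for M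
  have q0: "q M = 0" if "rank1 M" for M
    using rank1_minors[OF that, of j j l l] by (simp add: q_def dbl)
  have q1: "q M = 1" if "M \<noteq> 0" "\<not> rank1 M" for M
  proof (rule ccontr)
    assume "q M \<noteq> 1"
    then have "q M = 0" using two(1) by blast
    then have e: "M $ j $ j * M $ l $ l = M $ j $ l * M $ l $ j"
      using minus_one_eq_iff[OF two(2)] by (simp add: q_def)
    have "M $ a $ b * M $ c $ d = M $ a $ d * M $ c $ b" for a b c d
      using idx[of a] idx[of b] idx[of c] idx[of d] e
      by (elim disjE) (simp_all add: mult.commute)
    then show False using that unfolding rank1_iff_minors by blast
  qed
  have "\<not> rank1 A" using none A by blast
  then have qA: "A $ j $ j * A $ l $ l + A $ j $ l * A $ l $ j = 1" using q1[OF A(1)] by (simp add: q_def)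
  \<comment> \<open>The adjugate of \<open>A\<close>, which is its inverse because the determinant
    is 1.\<close>
  define Y :: "'s ^ 'n ^ 'n" where
    "Y = (\<chi> a b. if a = j then if b = j then A $ l $ l else A $ j $ l
      else if b = j then A $ l $ j else A $ j $ j)"
  have "(A ** Y) $ a $ b = mat 1 $ a $ b" for a b
  proof -
    have "(A ** Y) $ a $ b = A $ a $ j * Y $ j $ b + A $ a $ l * Y $ l $ b"
      unfolding matrix_matrix_mult_def vec_lambda_beta jl(1) using jl(2) by simp
    then show ?thesis using idx[of a] idx[of b] jl(2) qA
      by (elim disjE) (simp_all add: Y_def mat_def mult.commute add.commute dbl)
  qed
  then have AY: "A ** Y = mat 1" by (simp add: vec_eq_iff)
  have I: "green_J A (mat 1)"
    unfolding green_J_def leq_J_def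
  proof (intro conjI exI)
    show "A = A ** mat 1 ** mat 1" "mat 1 = mat 1 ** A ** Y" by (simp_all add: AY)
  qed
  have S: "(munit j l + munit l j) ** (munit j l + munit l j) = (mat 1 :: 's ^ 'n ^ 'n)"
    unfolding vec_eq_iff
  proof (intro allI)
    fix a b show "((munit j l + munit l j) ** (munit j l + munit l j)) $ a $ b = (mat 1 :: 's ^ 'n ^ 'n) $ a $ b"
      using idx[of a] idx[of b]
      by (elim disjE) (use jl(2) in \<open>simp_all add: matrix_add_rdistrib munit_mult_nth mat_def\<close>)
  qed
  have "mat 1 = (munit j j + munit l l :: 's ^ 'n ^ 'n)"
    unfolding vec_eq_iff
  proof (intro allI)
    fix a b show "mat 1 $ a $ b = (munit j j + munit l l :: 's ^ 'n ^ 'n) $ a $ b"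
      using idx[of a] idx[of b] by (elim disjE) (use jl(2) in \<open>simp_all add: mat_def\<close>)
  qed
  then have "green_J A (munit j j + munit l l)" using I by simp
  moreover have "green_J (mat 1) (munit j l + munit l j :: 's ^ 'n ^ 'n)"
    using green_J_mult_right[OF S, of "mat 1"] by simp
  then have "green_J A (munit j l + munit l j)" using I green_J_trans by blast
  ultimately have "rank1 (T (munit j j + munit l l))" "rank1 (T (munit j l + munit l j))"
    using T(3) A(2) green_J_rank1 unfolding preserves_def by blast+
  then have z: "q (T (munit j j) + T (munit l l)) = 0" "q (T (munit j l) + T (munit l j)) = 0"
    using q0 by (simp_all add: mat_linear_add[OF T(2)])
  have one: "q (T E) = 1" if "rank1 E" for E
    using q1 none[OF that] that mat_linear_eq_0_iff[OF T(2,1)] by (auto simp: rank1_def)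
  have q: "q (T (munit j j)) = 1" "q (T (munit j l)) = 1" "q (T (munit l j)) = 1" "q (T (munit l l)) = 1"
    by (simp_all add: one)
  have pair: "q (T (munit j j) + T (munit j l)) = 1" "q (T (munit l j) + T (munit l l)) = 1"
    "q (T (munit j j) + T (munit l j)) = 1" "q (T (munit j l) + T (munit l l)) = 1"
    using one[OF rank1_munit_add_munit_row[of j l j]] one[OF rank1_munit_add_munit_row[of j l l]]
      one[OF rank1_munit_add_munit_column[of j l j]] one[OF rank1_munit_add_munit_column[of j l l]] jl(2)
    by (simp_all add: mat_linear_add[OF T(2)])
  have "outer 1 1 = (munit j j + munit j l + munit l j + munit l l :: 's ^ 'n ^ 'n)"
    unfolding vec_eq_iff
  proof (intro allI)
    fix a b show "outer 1 1 $ a $ b = (munit j j + munit j l + munit l j + munit l l :: 's ^ 'n ^ 'n) $ a $ b"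
      using idx[of a] idx[of b] by (elim disjE) (use jl(2) in simp_all)
  qed
  moreover have "rank1 (outer 1 1 :: 's ^ 'n ^ 'n)" by (intro rank1_outer) (auto simp: vec_eq_iff)
  ultimately have all: "q (T (munit j j) + T (munit j l) + T (munit l j) + T (munit l l)) = 1"
    using one by (metis mat_linear_add[OF T(2)])
  \<comment> \<open>Polarisation of a quadratic form on four vectors. The pairs in a line contribute
    four ones and the two diagonals zeros, while the sum of all four has value 1.\<close>
  have "q (a + b + c + d) + (q a + q a) + (q b + q b) + (q c + q c) + (q d + q d)
      = q (a + b) + q (c + d) + q (a + c) + q (b + d) + q (a + d) + q (b + c)" for a b c d
    unfolding q_def by (simp add: distrib_left distrib_right ac_simps)
  from this[of "T (munit j j)" "T (munit j l)" "T (munit l j)" "T (munit l l)"]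
  have "1 = (0 :: 's)" using all pair z q by (simp add: dbl two(2))
  then show False by simp
qed

text \<open>Assuming the contrary, \<open>A\<close> with \<open>T A\<close> of rank one is varied
  within its J-class by column operations. The differences have rank one, so by assumption their
  images do not. A third scalar, a third index, or exactly two indices give three separate
  contradictions.\<close>

lemma preserves_green_J_obtain_rank1:
  fixes T :: "'s::semifield ^ 'n::finite ^ 'n \<Rightarrow> 's ^ 'n ^ 'n"
  assumes m: "1 + m = (0 :: 's)" and T: "bij T" "mat_linear T" "preserves T green_J"
  obtains E where "rank1 E" "rank1 (T E)"
proof (rule ccontr)
  assume "\<not> thesis"
  with that have none: "\<not> rank1 (T E)" if "rank1 E" for E using \<open>rank1 E\<close> by blast
  obtain z :: 'n where True by blast
  obtain A where "T A = munit z z" using surjD[OF bij_is_surj[OF T(1)], of "munit z z"] by metis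
  then have TA: "rank1 (T A)" by simp
  then have "A \<noteq> 0" using mat_linear_0[OF T(2)] by (auto simp: rank1_def)
  then obtain r j where rj: "A $ r $ j \<noteq> 0" by (auto simp: vec_eq_iff)
  \<comment> \<open>With a single index every nonzero matrix has rank one, so \<open>A\<close>
    itself would be an example.\<close>
  have "\<exists>l. l \<noteq> j"
  proof (rule ccontr)
    assume "\<not> ?thesis"
    then have eq: "i = j" for i by blast
    have "rank1 A" unfolding rank1_iff_minors using \<open>A \<noteq> 0\<close> by (metis eq)
    then show False using none TA by blast
  qed
  then obtain l where l: "l \<noteq> j" by blast
  \<comment> \<open>These matrices have column \<open>j\<close> of \<open>A\<close> as left factor.
    For \<open>w $ j = 0\<close>, adding \<open>G w\<close> to \<open>A\<close> is a transvection
    and stays in the J-class.\<close>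
  define G :: "'s ^ 'n \<Rightarrow> 's ^ 'n ^ 'n" where "G w = A ** outer (axis j 1) w" for w
  have G: "G w $ a $ b = A $ a $ j * w $ b" for w a b
    unfolding G_def mult_outer by (simp add: matrix_vector_mult_def axis_nth if_distrib cong: if_cong)
  have G_add: "G (v + w) = G v + G w" for v w by (simp add: vec_eq_iff G distrib_left)
  have G_scale: "mat_scale s (G w) = G (s *s w)" for s w by (simp add: vec_eq_iff G mult_ac)
  have G_inj: "v = w" if "G v = G w" for v w
  proof -
    have "A $ r $ j * v $ b = A $ r $ j * w $ b" for b using G that by metis
    then show ?thesis using rj by (simp add: vec_eq_iff)
  qed
  have G_rank1: "rank1 (G w)" if "w \<noteq> 0" for w
  proof -
    have "G w \<noteq> 0" using G_inj[of w 0] that by (auto simp: vec_eq_iff G)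
    then show ?thesis unfolding rank1_def G_def mult_outer by blast
  qed
  have J: "rank1 (T B)" if "green_J A B" for B
    using T(3) TA that green_J_rank1 unfolding preserves_def by blast
  have J_scale: "rank1 (T (mat_scale s A + G w))" if "s \<noteq> 0" "w $ j = 0" for s w
  proof -
    have "green_J A (A + G (sinv s *s w))"
      unfolding G_def by (rule green_J_transvection[OF m]) (simp add: that)
    moreover have "mat_scale s (A + G (sinv s *s w)) = mat_scale s A + G w"
      using that(1) by (simp add: mat_scale_add G_scale vec_eq_iff mult.assoc[symmetric])
    then have "green_J (A + G (sinv s *s w)) (mat_scale s A + G w)"
      using green_J_mat_scale[OF that(1)] by metis
    ultimately show ?thesis using J green_J_trans by blast
  qed
  have J_G: "rank1 (T (A + G w))" if "w $ j = 0" for w using J_scale[of 1] that by simp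
  have m0: "m \<noteq> 0" using m by auto
  show False
  proof (cases "\<exists>t :: 's. t \<noteq> 0 \<and> t \<noteq> 1")
    case True
    then obtain t :: 's where t: "t \<noteq> 0" "t \<noteq> 1" by blast
    \<comment> \<open>On the pencil \<open>T A + s ?Y\<close> the value at \<open>s = 1\<close> is
      \<open>T (G ?e)\<close>. At \<open>s = t\<close> the multiple of \<open>A\<close> does not
      vanish because \<open>t\<close> differs from 1, so the value has rank one there.\<close>
    let ?e = "axis l 1 :: 's ^ 'n"
    let ?Y = "T (mat_scale m A + G ?e)"
    have e: "?e $ j = 0" using l by (simp add: axis_nth)
    have s0: "1 + t * m \<noteq> 0" using minus_one_eq_iff[OF m, of 1 t] t by (simp add: mult.commute)
    have "T A + mat_scale t ?Y = T (A + mat_scale t (mat_scale m A + G ?e))"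
      by (simp add: mat_linear_add[OF T(2)] mat_linear_scale[OF T(2)])
    also have "A + mat_scale t (mat_scale m A + G ?e) = mat_scale (1 + t * m) A + G (t *s ?e)"
      by (simp add: vec_eq_iff G distrib_left distrib_right ac_simps)
    finally have 1: "rank1 (T A + mat_scale t ?Y)"
      using J_scale[OF s0, of "t *s ?e"] e by simp
    have "T A + ?Y = T ((A + mat_scale m A) + G ?e)"
      by (simp add: mat_linear_add[OF T(2)] add.assoc)
    then have 2: "T A + ?Y = T (G ?e)" by (simp add: minus_one_mat_add[OF m])
    have r: "rank1 (G ?e)" by (intro G_rank1) simp
    then have "T A + ?Y \<noteq> 0" using 2 mat_linear_eq_0_iff[OF T(2,1)] by (auto simp: rank1_def)
    then have "rank1 (T A + ?Y)" using rank1_pencil[OF m TA J_scale[OF m0 e] 1 t(1)] by blast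
    then show False using none[OF r] 2 by simp
  next
    case False
    then have two: "x = 0 \<or> x = 1" for x :: 's by blast
    then have two': "1 + 1 = (0 :: 's)" using m m0 by metis
    have dbl: "B + B = 0" for B :: "'s ^ 'n ^ 'n" using char2_mat_eq_iff[OF two'] by blast
    show False
    proof (cases "\<exists>q. q \<noteq> j \<and> q \<noteq> l")
      case True
      then obtain p where p: "p \<noteq> j" "p \<noteq> l" by blast
      \<comment> \<open>The vectors 0, \<open>?e\<close>, \<open>?f\<close>, \<open>?e + ?f\<close>
        form a plane over the two-element field. The four images sum to zero, and their pairwise
        sums are images of matrices \<open>G w\<close>.\<close>
      let ?e = "axis l 1 :: 's ^ 'n" and ?f = "axis p 1 :: 's ^ 'n"
      let ?X = "\<lambda>w. T (A + G w)"
      have X: "?X v + ?X w = T (G (v + w))" for v w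
      proof -
        have "?X v + ?X w = T ((A + A) + G (v + w))"
          unfolding G_add by (simp add: mat_linear_add[OF T(2)] add_ac)
        then show ?thesis by (simp add: dbl)
      qed
      have X_none: "\<not> rank1 (?X v + ?X w)" for v w
      proof (cases "v + w = 0")
        case True
        have "G 0 = 0" by (simp add: vec_eq_iff G)
        with True show ?thesis by (simp add: X mat_linear_0[OF T(2)] rank1_def)
      next
        case False
        then show ?thesis unfolding X by (intro none G_rank1)
      qed
      have X_inj: "v = w" if "?X v = ?X w" for v w
      proof -
        have "A + G v = A + G w" using injD[OF bij_is_inj[OF T(1)] that] .
        then have "G v = G w" by (simp add: vec_eq_iff minus_one_add_cancel[OF m])
        then show ?thesis by (rule G_inj)
      qed
      have ef: "?e $ j = 0" "?f $ j = 0" using l p by (auto simp: axis_nth)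
      have ne: "?e \<noteq> 0" "?f \<noteq> 0" "?e + ?f \<noteq> 0" "?e \<noteq> ?f" "?e \<noteq> ?e + ?f" "?f \<noteq> ?e + ?f"
      proof -
        show "?e + ?f \<noteq> 0" using p by (intro axis_add_axis_nonzero) auto
        then show "?e \<noteq> ?f" using char2_vec_eq_iff[OF two'] by blast
        show "?e \<noteq> ?e + ?f" 
        proof
          assume "?e = ?e + ?f"
          from arg_cong[OF this, of "\<lambda>v. v $ p"] show False using p by (simp add: axis_nth)
        qed
        show "?f \<noteq> ?e + ?f"
        proof
          assume "?f = ?e + ?f"
          from arg_cong[OF this, of "\<lambda>v. v $ l"] show False using p by (simp add: axis_nth)
        qed
      qed simp_all
      show False
      proof (rule four_rank1_sum_0[OF two two', of "?X 0" "?X ?e" "?X ?f" "?X (?e + ?f)"])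
        show "rank1 (?X 0)" "rank1 (?X ?e)" "rank1 (?X ?f)" "rank1 (?X (?e + ?f))"
          using ef by (intro J_G; simp)+
        have "?X 0 + ?X ?e + ?X ?f + ?X (?e + ?f) = (?X 0 + ?X ?e) + (?X ?f + ?X (?e + ?f))"
          by (simp only: add.assoc)
        also have "\<dots> = T (G ?e) + T (G (?f + (?e + ?f)))" unfolding X by simp
        also have "?f + (?e + ?f) = ?e + (?f + ?f)" by (simp add: add_ac)
        also have "?f + ?f = 0" using char2_vec_eq_iff[OF two'] by blast
        finally show "?X 0 + ?X ?e + ?X ?f + ?X (?e + ?f) = 0" by (simp add: dbl)
        show "distinct [?X 0, ?X ?e, ?X ?f, ?X (?e + ?f)]"
          using ne by (auto dest!: X_inj)
        show False if "Y \<in> {?X 0, ?X ?e, ?X ?f, ?X (?e + ?f)}" "Z \<in> {?X 0, ?X ?e, ?X ?f, ?X (?e + ?f)}"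
          "rank1 (Y + Z)" for Y Z
          using that X_none by (elim insertE emptyE) blast+
      qed
    next
      case False
      then have "UNIV = {j, l}" by blast
      then show False
        using char2_two_dim_contradiction[OF two two' _ l[symmetric] T none \<open>A \<noteq> 0\<close> TA] by blast
    qed
  qed
qed

text \<open>Rank one matrices form one J-class, so a single one with image of rank one settles all
  of them.\<close>

lemma preserves_green_J_mult_hadamard_form:
  fixes T :: "'s::semifield ^ 'n::finite ^ 'n \<Rightarrow> 's ^ 'n ^ 'n"
  assumes T: "bij T" "mat_linear T" "preserves T green_J"
  shows "(\<forall>A. rank1 A \<longrightarrow> rank1 (T A)) \<and> (\<exists>P C Q. mult_hadamard_form T P C Q)"
proof -
  have rank1: "rank1 (T A)" if "rank1 A" "rank1 E" "rank1 (T E)" for A E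
  proof -
    have "green_J E A" using that rank1_imp_leq_J unfolding green_J_def by blast
    then show ?thesis using T(3) that(3) green_J_rank1 unfolding preserves_def by blast
  qed
  show ?thesis
  proof (cases "zerosumfree TYPE('s)")
    case True
    then obtain s k l where s: "\<And>i j. s i j \<noteq> 0"
      "\<And>i j. T (munit i j) = mat_scale (s i j) (munit (k i j) (l i j))"
      using zerosumfree_mat_linear_munit[OF True T(1,2)] by metis
    have r: "rank1 (T (munit i j))" for i j by (simp add: s rank1_mat_scale)
    have "\<exists>P C Q. mult_hadamard_form T P C Q"
    proof (rule mult_hadamard_form_if_lines[OF T(1,2) r])
      fix i j i' j' x y x' y'
      assume "rank1 (munit i j + munit i' j' :: 's ^ 'n ^ 'n)"
        and xy: "T (munit i j) = outer x y" "T (munit i' j') = outer x' y'"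
      then have "rank1 (T (munit i j) + T (munit i' j'))"
        using rank1[OF _ rank1_munit r] by (metis mat_linear_add[OF T(2)])
      \<comment> \<open>If the two target cells shared no line, this minor would equate the product
        of the two scalars with zero.\<close>
      from rank1_minors[OF this, of "k i j" "l i j" "k i' j'" "l i' j'"]
      have "k i j = k i' j' \<or> l i j = l i' j'" using s(1) by (auto simp: s(2) split: if_splits)
      then show "par x x' \<or> par y y'"
        using lines_if_scaled_munits[OF s(1) s(1)] xy s(2) by metis
    qed blast
    then show ?thesis using rank1[OF _ rank1_munit r] by blast
  next
    case False
    then obtain m :: 's where m: "1 + m = 0" by (rule not_zerosumfree_imp_minus_one)
    obtain E where "rank1 E" "rank1 (T E)" using preserves_green_J_obtain_rank1[OF m T] .
    then have r: "rank1 (T A)" if "rank1 A" for A using rank1 that by blast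
    have "\<exists>P C Q. mult_hadamard_form T P C Q"
      by (rule mult_hadamard_form_if_lines[OF T(1,2) r[OF rank1_munit] lines_if_minus_one[OF m T(2) r]]) blast+
    then show ?thesis using r by blast
  qed
qed

lemma preserves_green_J_imp_standard_form:
  fixes T :: "'s::semifield ^ 'n::finite ^ 'n \<Rightarrow> 's ^ 'n ^ 'n"
  assumes T: "bij T" "mat_linear T" "preserves T green_J"
  shows "standard_form T"
proof -
  obtain P C Q where form: "mult_hadamard_form T P C Q" and r: "\<And>A. rank1 A \<Longrightarrow> rank1 (T A)"
    using preserves_green_J_mult_hadamard_form[OF T] by blast
  then obtain P' Q' F where PQ: "P' ** P = mat 1" "Q ** Q' = mat 1"
    and C: "\<And>i j. C $ i $ j \<noteq> 0" and F: "F = id \<or> F = transpose"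
    and TA: "\<And>A. T A = P ** hadamard C (F A) ** Q"
    unfolding mult_hadamard_form_def invertible_def by blast
  \<comment> \<open>The all-ones matrix is the unit of the entrywise product and is symmetric, so
    its image exposes \<open>C\<close> between \<open>P\<close> and \<open>Q\<close>.\<close>
  have "hadamard C (F (outer 1 1)) = C"
    using F by (auto simp: vec_eq_iff transpose_def)
  then have "T (outer 1 1) = P ** C ** Q" by (simp add: TA)
  moreover have "rank1 (outer 1 1 :: 's ^ 'n ^ 'n)" by (intro rank1_outer) (auto simp: vec_eq_iff)
  ultimately have "rank1 (P ** C ** Q)" using r by metis
  moreover have "P' ** (P ** C ** Q) ** Q' = (P' ** P) ** C ** (Q ** Q')"
    by (simp only: matrix_mul_assoc)
  then have "leq_J C (P ** C ** Q)" unfolding leq_J_def using PQ by (metis matrix_mul_lid matrix_mul_rid)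
  moreover have "C \<noteq> 0" using C by (auto simp: vec_eq_iff)
  ultimately have "rank1 C" using leq_J_rank1 by blast
  then show ?thesis
    using mult_hadamard_form_rank1[OF T(1) form] unfolding standard_form_def by blast
qed

theorem theorem5p2:
  fixes T :: "'s::semifield ^ 'n::finite ^ 'n \<Rightarrow> 's ^ 'n ^ 'n"
  assumes "bij T" and "mat_linear T"
  shows "(preserves T green_J \<longleftrightarrow> preserves T leq_J)
    \<and> (preserves T leq_J \<longleftrightarrow> preserves T green_H)
    \<and> (preserves T green_H \<longleftrightarrow> preserves T leq_H)
    \<and> (preserves T leq_H \<longleftrightarrow>
        (\<exists>P Q. invertible P \<and> invertible Q \<and>
          ((\<forall>A. T A = P ** A ** Q) \<or> (\<forall>A. T A = P ** transpose A ** Q))))"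
proof -
  have "preserves T leq_J \<Longrightarrow> preserves T green_J" "preserves T leq_H \<Longrightarrow> preserves T green_H"
    unfolding preserves_def green_J_def green_H_def by blast+
  moreover note preserves_green_J_imp_standard_form[OF assms] preserves_green_H_imp_standard_form[OF assms]
    standard_form_preserves_leq_J[of T] standard_form_preserves_leq_H[of T]
  ultimately show ?thesis unfolding standard_form_def[symmetric] by blast
qed

end
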